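(* Let $s\ge 2$ and let $\mathcal C(\mathbf x)\in\mathbb Z[x_1,\ldots,x_s]$ be a cubic form with integer coefficients which is not of the shape $a(b_1x_1+\cdots+b_sx_s)^3$ with $a,b_1,\ldots,b_s\in\mathbb Q$. For $P\ge 1$ let $M(P)$ denote the number of pairs $(\mathbf x,\mathbf X)$ of integer vectors $\mathbf x,\mathbf X\in\mathbb Z^s\cap[-P,P]^s$ with $\mathcal C(\mathbf x)=\mathcal C(\mathbf X)$. Then for every $\varepsilon>0$, \[ M(P)\ll P^{2s-2+\varepsilon}. \]
   Context: The notation $F\ll G$ means $|F|\le KG$ for some constant $K$; here $K$ may depend on $\varepsilon$ and on the form $\mathcal C$ (and $s$), but not on $P$. *)

theory Defs
  imports Complex_Main "HOL-Library.Poly_Mapping" "HOL-Library.FuncSet"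
begin

text \<open>
  Polynomials over \<open>'a\<close> in the variables \<open>x\<^sub>0, x\<^sub>1, \<dots>\<close> are finitely supported maps from
  monomials (exponent vectors \<open>nat \<Rightarrow>\<^sub>0 nat\<close>) to coefficients; the ring structure is the
  convolution product of \<^theory>\<open>HOL-Library.Poly_Mapping\<close>. The variables
  \<open>x\<^sub>1, \<dots>, x\<^sub>s\<close> of the mathematical text are numbered \<open>0, \<dots>, s - 1\<close>.
\<close>

type_synonym 'a mpolynomial = "(nat \<Rightarrow>\<^sub>0 nat) \<Rightarrow>\<^sub>0 'a"

definition mvar :: "nat \<Rightarrow> 'a::zero_neq_one mpolynomial" where
  "mvar i = Poly_Mapping.single (Poly_Mapping.single i 1) 1"

definition mconst :: "'a::zero \<Rightarrow> 'a mpolynomial" where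
  "mconst a = Poly_Mapping.single 0 a"

definition meval :: "'a::comm_semiring_1 mpolynomial \<Rightarrow> (nat \<Rightarrow> 'a) \<Rightarrow> 'a" where
  "meval p x = (\<Sum>m\<in>Poly_Mapping.keys p.
     Poly_Mapping.lookup p m * (\<Prod>i\<in>Poly_Mapping.keys m. x i ^ Poly_Mapping.lookup m i))"

text \<open>The zero polynomial counts as a cubic form here.\<close>

definition cubic_form :: "nat \<Rightarrow> 'a::zero mpolynomial \<Rightarrow> bool" where
  "cubic_form s p \<longleftrightarrow> (\<forall>m\<in>Poly_Mapping.keys p.
     Poly_Mapping.keys m \<subseteq> {..<s} \<and>
     (\<Sum>i\<in>Poly_Mapping.keys m. Poly_Mapping.lookup m i) = 3)"

text \<open>
  The equation is an identity in the polynomial ring over the rationals. The choice \<open>a = 0\<close>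
  (or \<open>b = 0\<close>) is allowed, so the zero form has this shape.
\<close>

definition rational_multiple_of_cube :: "nat \<Rightarrow> int mpolynomial \<Rightarrow> bool" where
  "rational_multiple_of_cube s C \<longleftrightarrow> (\<exists>(a::rat) (b::nat \<Rightarrow> rat).
     Poly_Mapping.map of_int C = mconst a * (\<Sum>i<s. mconst (b i) * mvar i) ^ 3)"

text \<open>
  A vector in \<open>\<int>\<^sup>s\<close> is a function on \<open>{..<s}\<close>, extended by \<open>undefined\<close> (via \<open>\<rightarrow>\<^sub>E\<close>) so that
  each vector has a unique representative. The bound \<open>P\<close> is real.
\<close>

definition int_box :: "nat \<Rightarrow> real \<Rightarrow> (nat \<Rightarrow> int) set" where
  "int_box s P = {..<s} \<rightarrow>\<^sub>E {n. - P \<le> of_int n \<and> of_int n \<le> P}"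

definition num_pairs :: "nat \<Rightarrow> int mpolynomial \<Rightarrow> real \<Rightarrow> nat" where
  "num_pairs s C P = card {(x, X). x \<in> int_box s P \<and> X \<in> int_box s P \<and> meval C x = meval C X}"

text \<open>Guards against \<open>card\<close> of an infinite set being \<open>0\<close>.\<close>

lemma finite_solution_pairs:
  "finite {(x, X). x \<in> int_box s P \<and> X \<in> int_box s P \<and> meval C x = meval C X}"
proof -
  have "{n::int. - P \<le> of_int n \<and> of_int n \<le> P} \<subseteq> {\<lceil>- P\<rceil>..\<lfloor>P\<rfloor>}"
    by (auto simp: ceiling_le_iff le_floor_iff)
  then have "finite {n::int. - P \<le> of_int n \<and> of_int n \<le> P}"
    by (rule finite_subset) simp
  then have "finite (int_box s P)"
    unfolding int_box_def by (intro finite_PiE) auto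
  then have "finite (int_box s P \<times> int_box s P)" by simp
  then show ?thesis
    by (rule rev_finite_subset) auto
qed

end

theory Submission
  imports Defs "HOL-Computational_Algebra.Primes" "HOL-Computational_Algebra.Polynomial"
begin

text \<open>
  Let \<open>T\<close> be the symmetric trilinear form with \<open>T x x x = 6 C(x)\<close>. With \<open>h = x - X\<close> and
  \<open>y = x + X\<close> the equation \<open>C(x) = C(X)\<close> becomes \<open>3 T h y y + T h h h = 0\<close>, for each \<open>h\<close> a quadric
  in \<open>y\<close> without linear terms. Since \<open>C\<close> is not a multiple of a cube, some principal
  \<open>2 \<times> 2\<close> minor of the Hessian form \<open>T h\<close> does not vanish identically in \<open>h\<close>. If the minor and
  \<open>T h h h\<close> are nonzero at \<open>h\<close>, fixing all but two of the \<open>y\<^sub>i\<close> leaves a binary quadratic form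
  representing an integer, with \<open>O(P powr \<epsilon>)\<close> solutions uniformly in \<open>h\<close>, outside a thin set of
  the fixed \<open>y\<^sub>i\<close>. The remaining \<open>h\<close> lie on two hypersurfaces, where the quadric is still nontrivial
  in \<open>y\<close>, or in the radical \<open>{h. T h = 0}\<close>, which has codimension at least two.

  For binary forms the uniform bound reduces to \<open>z\<^sup>2 - D w\<^sup>2 = N\<close>: up to \<open>N powr \<epsilon>\<close> classes, two
  solutions differ by a unit of integral trace, and such units grow geometrically.
\<close>

section \<open>The divisor bound\<close>

text \<open>The three kinds of \<open>h\<close> balance: generic ones contribute the exponent
  \<open>s + (s - 2)\<close>, those on the hypersurfaces \<open>(s - 1) + (s - 1)\<close>, and the
  radical \<open>(s - 2) + s\<close>. So codimension two of the radical is exactly what is required.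
  For a multiple of a cube the radical is a hyperplane, or everything, and the bound breaks down.

  The obstacle is uniformity. The coefficients of \<open>T h\<close> grow with \<open>P\<close>, and
  its minors are arbitrary nonzero integers, perfect squares included, so a constant depending on
  the order generated by \<surd>D (through class numbers or fundamental units, say) is useless. In
  place of ideal factors of \<open>N\<close>, a solution is classified by the gcd of
  \<open>N\<close> with the \<surd>D-coefficient of its product with the conjugate of one fixed
  solution. This takes at most as many values as \<open>N\<close> has divisors, whatever
  \<open>D\<close> is. The size of \<open>D\<close> then enters only through logarithms and divisor
  counts of integers that are polynomially bounded in \<open>P\<close>, and both are absorbed by
  \<epsilon>.\<close>

definition ndiv :: "nat \<Rightarrow> nat" where
  "ndiv n = card {d. d dvd n}"

lemma finite_divisors_pos: "n > 0 \<Longrightarrow> finite {d::nat. d dvd n}"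
  using finite_divisors_nat by blast

lemma ndiv_mult_le:
  assumes "a > 0" "b > 0"
  shows "ndiv (a * b) \<le> ndiv a * ndiv b"
proof -
  have "{d. d dvd a * b} \<subseteq> (\<lambda>(x, y). x * y) ` ({d. d dvd a} \<times> {d. d dvd b})"
    by (auto simp: image_iff dest!: division_decomp)
  then have "ndiv (a * b) \<le> card ((\<lambda>(x, y). x * y) ` ({d. d dvd a} \<times> {d. d dvd b}))"
    unfolding ndiv_def using assms
    by (intro card_mono finite_imageI finite_cartesian_product finite_divisors_pos)
  also have "\<dots> \<le> card ({d. d dvd a} \<times> {d. d dvd b})"
    using assms by (intro card_image_le finite_cartesian_product finite_divisors_pos)
  finally show ?thesis by (simp add: ndiv_def card_cartesian_product)
qed

lemma ndiv_dvd_mono: "m dvd n \<Longrightarrow> n > 0 \<Longrightarrow> ndiv m \<le> ndiv n"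
  unfolding ndiv_def by (intro card_mono finite_divisors_pos) (auto intro: dvd_trans)

lemma ndiv_prime_power:
  assumes "prime p"
  shows "ndiv (p ^ a) \<le> a + 1"
proof -
  have "{d. d dvd p ^ a} \<subseteq> (\<lambda>i. p ^ i) ` {..a}"
    using divides_primepow_nat[OF assms] by auto
  then have "ndiv (p ^ a) \<le> card ((\<lambda>i. p ^ i) ` {..a})"
    unfolding ndiv_def by (intro card_mono) auto
  also have "\<dots> \<le> card {..a}" by (rule card_image_le) simp
  finally show ?thesis by simp
qed

lemma ndiv_prod_le:
  assumes "finite A" "\<And>p. p \<in> A \<Longrightarrow> f p > 0"
  shows "ndiv (\<Prod>p\<in>A. f p) \<le> (\<Prod>p\<in>A. ndiv (f p))"
  using assms
proof (induction A rule: finite_induct)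
  case empty
  have "{d::nat. d dvd 1} = {1}" by auto
  then show ?case by (simp add: ndiv_def)
next
  case (insert x F)
  have "ndiv (f x * prod f F) \<le> ndiv (f x) * ndiv (prod f F)"
    using insert by (intro ndiv_mult_le prod_pos) auto
  also have "\<dots> \<le> ndiv (f x) * (\<Prod>p\<in>F. ndiv (f p))"
    using insert by (intro mult_le_mono) auto
  finally show ?case using insert by simp
qed

lemma linear_le_exp_bound:
  fixes \<epsilon> :: real
  assumes "\<epsilon> > 0"
  shows "real a + 1 \<le> (1 + 1 / (\<epsilon> * ln 2)) * 2 powr (real a * \<epsilon>)"
proof -
  define x where "x = real a * (\<epsilon> * ln 2)"
  have c: "\<epsilon> * ln 2 > 0" using assms by simp
  have x0: "x \<ge> 0" using c by (simp add: x_def)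
  have e: "2 powr (real a * \<epsilon>) = exp x" by (simp add: powr_def x_def mult_ac)
  have "real a + 1 = x / (\<epsilon> * ln 2) + 1" using c assms by (simp add: x_def)
  also have "\<dots> \<le> exp x / (\<epsilon> * ln 2) + exp x"
    using exp_ge_add_one_self[of x] x0 c by (intro add_mono divide_right_mono) linarith+
  also have "\<dots> = (1 + 1 / (\<epsilon> * ln 2)) * exp x" by (simp add: field_simps)
  finally show ?thesis unfolding e .
qed

text \<open>For primes \<open>p \<ge> 2 powr (1 / \<epsilon>)\<close> the local factor \<open>(a + 1) / p powr (a \<epsilon>)\<close> is at most one,
  and each of the finitely many remaining primes contributes a bounded factor.\<close>

lemma divisor_bound:
  fixes \<epsilon> :: real
  assumes e: "\<epsilon> > 0"
  shows "\<exists>K\<ge>1. \<forall>n>0. real (ndiv n) \<le> K * real n powr \<epsilon>"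
proof -
  define k where "k = 1 + 1 / (\<epsilon> * ln 2)"
  have k1: "k \<ge> 1" unfolding k_def using e by simp
  define B where "B = nat \<lceil>2 powr (1 / \<epsilon>)\<rceil>"
  have loc: "real a + 1 \<le> (if p < B then k else 1) * real p powr (real a * \<epsilon>)"
    if p: "prime p" for p a
  proof (cases "p < B")
    case True
    have "real p \<ge> 2" using prime_ge_2_nat[OF p] by simp
    then have "2 powr (real a * \<epsilon>) \<le> real p powr (real a * \<epsilon>)"
      using e by (intro powr_mono2) auto
    then have "k * 2 powr (real a * \<epsilon>) \<le> k * real p powr (real a * \<epsilon>)"
      using k1 by (intro mult_left_mono) auto
    with linear_le_exp_bound[OF e, of a] True show ?thesis by (simp add: k_def)
  next
    case False
    then have "real p \<ge> 2 powr (1 / \<epsilon>)" unfolding B_def by linarith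
    then have "real p powr (real a * \<epsilon>) \<ge> (2 powr (1 / \<epsilon>)) powr (real a * \<epsilon>)"
      using e by (intro powr_mono2) auto
    also have "(2 powr (1 / \<epsilon>)) powr (real a * \<epsilon>) = (2::real) ^ a"
      using e by (simp add: powr_powr powr_realpow)
    finally have ge: "(2::real) ^ a \<le> real p powr (real a * \<epsilon>)" .
    have "real a + 1 \<le> (2::real) ^ a"
    proof -
      have "a + 1 \<le> 2 ^ a" by (simp add: Suc_leI)
      then have "real (a + 1) \<le> real (2 ^ a)" by (rule of_nat_mono)
      then show ?thesis by simp
    qed
    with ge show ?thesis using False by simp
  qed
  have "real (ndiv n) \<le> k ^ B * real n powr \<epsilon>" if n: "n > 0" for n
  proof -
    let ?P = "prime_factors n" and ?m = "\<lambda>p. multiplicity p n"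
    have nn: "n = (\<Prod>p\<in>?P. p ^ ?m p)"
      using n by (simp add: prime_factorization_nat[symmetric])
    have pr: "\<And>p. p \<in> ?P \<Longrightarrow> prime p" by auto
    have "ndiv n \<le> (\<Prod>p\<in>?P. ndiv (p ^ ?m p))"
      using nn ndiv_prod_le[of ?P "\<lambda>p. p ^ ?m p"] pr
      by (metis finite_set_mset prime_gt_0_nat zero_less_power)
    also have "\<dots> \<le> (\<Prod>p\<in>?P. ?m p + 1)"
      using pr ndiv_prime_power by (intro prod_mono) auto
    finally have "real (ndiv n) \<le> real (\<Prod>p\<in>?P. ?m p + 1)" by (rule of_nat_mono)
    also have "\<dots> = (\<Prod>p\<in>?P. real (?m p) + 1)" by (simp add: add.commute)
    also have "\<dots> \<le> (\<Prod>p\<in>?P. (if p < B then k else 1) * real p powr (real (?m p) * \<epsilon>))"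
      using loc pr by (intro prod_mono) auto
    also have "\<dots> = (\<Prod>p\<in>?P. if p < B then k else 1) * (\<Prod>p\<in>?P. real p powr (real (?m p) * \<epsilon>))"
      by (rule prod.distrib)
    also have "(\<Prod>p\<in>?P. real p powr (real (?m p) * \<epsilon>)) = real n powr \<epsilon>"
    proof -
      have "(\<Prod>p\<in>?P. real p powr (real (?m p) * \<epsilon>)) = (\<Prod>p\<in>?P. (real p ^ ?m p) powr \<epsilon>)"
        using pr prime_gt_0_nat by (intro prod.cong) (auto simp: powr_powr[symmetric] powr_realpow)
      also have "\<dots> = (\<Prod>p\<in>?P. real p ^ ?m p) powr \<epsilon>"
        by (rule prod_powr_distrib[symmetric])
      also have "(\<Prod>p\<in>?P. real p ^ ?m p) = real n"
        by (subst (2) nn) simp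
      finally show ?thesis .
    qed
    also have "(\<Prod>p\<in>?P. if p < B then k else 1) = k ^ card {p\<in>?P. p < B}"
      by (subst prod.If_cases) (auto simp: Int_def)
    also have "k ^ card {p\<in>?P. p < B} \<le> k ^ B"
    proof (rule power_increasing[OF _ k1])
      have "card {p\<in>?P. p < B} \<le> card {..<B}" by (intro card_mono) auto
      then show "card {p\<in>?P. p < B} \<le> B" by simp
    qed
    finally show ?thesis by (simp add: mult_right_mono)
  qed
  moreover have "k ^ B \<ge> 1" using k1 by simp
  ultimately show ?thesis by blast
qed

section \<open>Integral points on norm equations\<close>

text \<open>Divisors that are not coprime need not have a product dividing \<open>m\<close>. Since
  gcd times lcm is the product, the loss is only their gcd, which \<open>trace_integral\<close>
  later removes.\<close>

lemma dvd_lcm_complement: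
  fixes d f m :: int
  assumes "d dvd m" "f dvd m"
  shows "d * f dvd gcd d f * m"
proof -
  have "lcm d f dvd m" using assms by (rule lcm_least)
  then have "gcd d f * lcm d f dvd gcd d f * m" by (rule mult_dvd_mono[OF dvd_refl])
  moreover have "gcd d f * lcm d f = \<bar>d * f\<bar>"
    by (simp add: abs_mult)
  ultimately show ?thesis by simp
qed

text \<open>Dividing by \<open>gcd N a\<close> leaves \<open>f\<close> coprime to the reduced
  \<open>a\<close>. The purpose is to split \<open>N\<close> between the two factors of
  \<open>z1^2 * w^2 - z^2 * w1^2\<close>.\<close>

lemma gcd_cofactor_dvd:
  fixes N a b :: int
  assumes "N dvd a * b" "N = gcd N a * f" "N \<noteq> 0"
  shows "f dvd b"
proof -
  have g0: "gcd N a \<noteq> 0" using assms by auto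
  obtain a' where a': "a = gcd N a * a'" by (meson dvdE gcd_dvd2)
  have "gcd N a * gcd f a' = gcd N a"
  proof -
    have "gcd (gcd N a * f) (gcd N a * a') = gcd N a"
      using assms(2) a' by presburger
    then show ?thesis using gcd_mult_distrib_int[of "gcd N a" f a'] by simp
  qed
  then have "gcd f a' = 1" using g0 by (metis mult_cancel_left2)
  then have cop: "coprime f a'" by (simp add: coprime_iff_gcd_eq_1)
  have "gcd N a * f dvd gcd N a * (a' * b)"
    using assms(1,2) a' by (metis mult.assoc)
  then have "f dvd a' * b" using g0 by (metis dvd_mult_cancel_left)
  then show ?thesis using cop by (simp add: coprime_dvd_mult_right_iff)
qed

lemma coprime_dvd_both_mult:
  fixes d x :: int
  assumes "coprime a b" "d dvd a * x" "d dvd b * x"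
  shows "d dvd x"
proof -
  have "d dvd gcd (a * x) (b * x)" using assms by simp
  also have "gcd (a * x) (b * x) = gcd a b * \<bar>x\<bar>"
    by (metis gcd_mult_distrib_int mult.commute abs_mult abs_gcd_int gcd_mult_right normalize_int_def gcd_mult_left)
  finally show ?thesis using assms(1) by simp
qed

text \<open>Modulo \<open>w\<close> the norm is \<open>z^2\<close>. Hence \<open>w\<close> may be
  cancelled in divisibilities by \<open>N\<close>.\<close>

lemma coprime_norm:
  fixes z w D N :: int
  assumes "z^2 - D * w^2 = N" "coprime z w"
  shows "coprime w N"
proof -
  have "coprime w (z^2)" using assms(2) by (simp add: coprime_commute)
  then have "coprime w (z^2 + w * (- D * w))"
    by (metis coprime_iff_gcd_eq_1 gcd_add_mult mult.commute add.commute)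
  moreover have "z^2 + w * (- D * w) = N" using assms(1) by (simp add: power2_eq_square algebra_simps)
  ultimately show ?thesis by simp
qed

text \<open>The three solutions stand for elements \<open>\<alpha>\<^sub>i = z\<^sub>i + w\<^sub>i \<surd>D\<close> of norm \<open>N\<close>. The conclusion says that
  the unit \<open>\<alpha>\<^sub>2 / \<alpha>\<^sub>3\<close> has integral trace.\<close>

lemma trace_integral:
  fixes D N :: int
  assumes s1: "z1^2 - D * w1^2 = N" and c1: "coprime z1 w1"
    and s2: "z2^2 - D * w2^2 = N" and c2: "coprime z2 w2"
    and s3: "z3^2 - D * w3^2 = N" and c3: "coprime z3 w3"
    and N: "N \<noteq> 0"
    and g2: "gcd N (z1 * w2 - z2 * w1) = d" and g3: "gcd N (z1 * w3 - z3 * w1) = d"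
  shows "N dvd 2 * (z2 * z3 - D * w2 * w3)"
proof -
  \<comment> \<open>\<open>d\<close> and \<open>f\<close> stand in for two conjugate ideal factors
    of \<open>N\<close>: \<open>d\<close> divides the \<surd>D-coefficient of
    \<open>\<alpha>\<^sub>i\<close> times the conjugate of \<open>\<alpha>\<^sub>1\<close>, and
    \<open>f\<close> that of \<open>\<alpha>\<^sub>i * \<alpha>\<^sub>1\<close>, for
    \<open>i = 2, 3\<close>.\<close>
  obtain f where f: "N = d * f" using g2 by (metis dvdE gcd_dvd1)
  have prod: "(z1 * w - z * w1) * (z1 * w + z * w1) = N * (w^2 - w1^2)"
    if "z^2 - D * w^2 = N" for z w
  proof -
    have "(z1 * w - z * w1) * (z1 * w + z * w1) = z1^2 * w^2 - z^2 * w1^2"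
      by (simp add: power2_eq_square algebra_simps)
    also have "\<dots> = (N + D * w1^2) * w^2 - (N + D * w^2) * w1^2"
      using s1 that by (simp add: algebra_simps)
    finally show ?thesis by (simp add: algebra_simps)
  qed
  have d2: "d dvd z1 * w2 - z2 * w1" and d3: "d dvd z1 * w3 - z3 * w1"
    using g2 g3 gcd_dvd2 by metis+
  have f2: "f dvd z1 * w2 + z2 * w1"
    using gcd_cofactor_dvd[of N "z1 * w2 - z2 * w1" _ f] prod[OF s2] g2 f N by auto
  have f3: "f dvd z1 * w3 + z3 * w1"
    using gcd_cofactor_dvd[of N "z1 * w3 - z3 * w1" _ f] prod[OF s3] g3 f N by auto
  \<comment> \<open>The product of \<open>\<alpha>\<^sub>2\<close> with the conjugate of
    \<open>\<alpha>\<^sub>3\<close> is \<open>n - m \<surd>D\<close>. Were \<open>d\<close> and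
    \<open>f\<close> coprime, \<open>N\<close> would divide both coordinates; in general it divides
    them only after multiplication by \<open>e\<close>.\<close>
  define m where "m = z2 * w3 - z3 * w2"
  define n where "n = z2 * z3 - D * w2 * w3"
  define e where "e = gcd d f"
  have "d dvd m"
  proof (rule coprime_dvd_both_mult[OF c1])
    have "z1 * m = z2 * (z1 * w3 - z3 * w1) - z3 * (z1 * w2 - z2 * w1)"
      by (simp add: m_def algebra_simps)
    then show "d dvd z1 * m" using d2 d3 by simp
    have "w1 * m = w2 * (z1 * w3 - z3 * w1) - w3 * (z1 * w2 - z2 * w1)"
      by (simp add: m_def algebra_simps)
    then show "d dvd w1 * m" using d2 d3 by simp
  qed
  moreover have "f dvd m"
  proof (rule coprime_dvd_both_mult[OF c1])
    have "z1 * m = z2 * (z1 * w3 + z3 * w1) - z3 * (z1 * w2 + z2 * w1)"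
      by (simp add: m_def algebra_simps)
    then show "f dvd z1 * m" using f2 f3 by simp
    have "w1 * m = w3 * (z1 * w2 + z2 * w1) - w2 * (z1 * w3 + z3 * w1)"
      by (simp add: m_def algebra_simps)
    then show "f dvd w1 * m" using f2 f3 by simp
  qed
  ultimately have Nm: "N dvd e * m" unfolding f e_def by (rule dvd_lcm_complement)
  have Nn: "N dvd e * n"
  proof -
    have "w3 * n = z3 * m + N * w2"
      unfolding n_def m_def s3[symmetric] by (simp add: power2_eq_square algebra_simps)
    then have "e * n * w3 = z3 * (e * m) + N * (e * w2)"
      by (metis distrib_left mult.assoc mult.commute)
    then have "N dvd e * n * w3" using Nm by simp
    then show ?thesis
      using coprime_norm[OF s3 c3] by (simp add: coprime_dvd_mult_left_iff coprime_commute)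
  qed
  have e0: "e \<noteq> 0" using N f unfolding e_def by auto
  \<comment> \<open>A common divisor of \<open>d\<close> and \<open>f\<close> divides the sum
    \<open>2 * z1 * w2\<close>, hence \<open>2 * z1\<close>, and its square divides
    \<open>N\<close>. The norm equation then forces the square into \<open>4 * D\<close>.\<close>
  have eD: "e^2 dvd 4 * D"
  proof -
    have ed: "e dvd d" and ef: "e dvd f" by (auto simp: e_def)
    have eN: "e^2 dvd N" unfolding f power2_eq_square using ed ef by (rule mult_dvd_mono)
    have "e dvd (z1 * w2 - z2 * w1) + (z1 * w2 + z2 * w1)"
      using ed ef d2 f2 by (meson dvd_add dvd_trans)
    then have "e dvd 2 * z1 * w2" by (simp add: mult_ac)
    moreover have "coprime e w2"
      using coprime_norm[OF s2 c2] ed f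
      by (metis coprime_commute coprime_divisors dvd_refl dvd_trans dvd_triv_left)
    ultimately have "e dvd 2 * z1" by (simp add: coprime_dvd_mult_left_iff)
    then have "e^2 dvd (2 * z1)^2" by (rule dvd_power_same)
    moreover have "(2 * z1)^2 = 4 * D * w1^2 + 4 * N" using s1 by (simp add: power_mult_distrib)
    ultimately have "e^2 dvd 4 * D * w1^2" using eN
      by (metis dvd_add_left_iff dvd_mult)
    moreover have "coprime e w1"
      using coprime_norm[OF s1 c1] ed f
      by (metis coprime_commute coprime_divisors dvd_refl dvd_trans dvd_triv_left)
    ultimately show ?thesis by (simp add: coprime_dvd_mult_left_iff)
  qed
  \<comment> \<open>The unit is \<open>(p - q \<surd>D) / e\<close> with norm one, so
    \<open>(2 * p)^2 = 4 * e^2 + 4 * D * q^2\<close>. As \<open>e^2\<close> divides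
    \<open>4 * D\<close>, the trace \<open>2 * p / e\<close> is an integer although
    \<open>p / e\<close> need not be.\<close>
  obtain p where p: "e * n = N * p" using Nn by blast
  obtain q where q: "e * m = N * q" using Nm by blast
  have "n^2 - D * m^2 = (z2^2 - D * w2^2) * (z3^2 - D * w3^2)"
    unfolding n_def m_def by (simp add: power2_eq_square algebra_simps)
  then have "n^2 - D * m^2 = N^2" using s2 s3 by (simp add: power2_eq_square)
  then have "(e * n)^2 - D * (e * m)^2 = e^2 * N^2"
    by (simp add: power_mult_distrib algebra_simps flip: right_diff_distrib)
  then have "N^2 * (p^2 - D * q^2) = N^2 * e^2"
    unfolding p q by (simp add: power_mult_distrib algebra_simps)
  then have pq: "p^2 - D * q^2 = e^2" using N by simp
  have "(2 * p)^2 = 4 * e^2 + 4 * D * q^2" using pq by (simp add: power_mult_distrib)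
  then have "e^2 dvd (2 * p)^2" using eD by (metis dvd_add dvd_mult2 dvd_triv_right)
  then have "e dvd 2 * p" by (metis pow_divides_pow_iff zero_less_numeral)
  then obtain r where r: "2 * p = e * r" by blast
  have "e * (2 * n) = N * (2 * p)" using p by simp
  also have "\<dots> = e * (N * r)" using r by simp
  finally have "2 * n = N * r" using e0 by simp
  then show ?thesis unfolding n_def by simp
qed

text \<open>For negative \<open>D\<close> a quotient of norm one lies on the unit circle, so its
  integral trace is one of five values. The trace and the sign of the imaginary part determine the
  quotient, which gives \<open>5 * 3\<close>.\<close>

lemma norm_class_bound_neg:
  fixes D N :: int
  assumes D: "D < 0" and N: "N \<noteq> 0"
    and X: "\<And>z w. (z, w) \<in> X \<Longrightarrow> z^2 - D * w^2 = N"
    and tr: "\<And>z w z' w'. (z, w) \<in> X \<Longrightarrow> (z', w') \<in> X \<Longrightarrow> N dvd 2 * (z * z' - D * w * w')"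
  shows "finite X \<and> card X \<le> 15"
proof (cases "X = {}")
  case False
  then obtain z3 w3 where x3: "(z3, w3) \<in> X" by auto
  define n where "n = (\<lambda>(z, w). z * z3 - D * w * w3)"
  define m where "m = (\<lambda>(z, w). z * w3 - z3 * w)"
  define \<phi> where "\<phi> = (\<lambda>x. (2 * n x div N, sgn (m x)))"
  have nm: "(n x)^2 - D * (m x)^2 = N^2" if "x \<in> X" for x
  proof -
    obtain z w where x: "x = (z, w)" by fastforce
    have "(n x)^2 - D * (m x)^2 = (z^2 - D * w^2) * (z3^2 - D * w3^2)"
      unfolding n_def m_def x by (simp add: power2_eq_square algebra_simps)
    then show ?thesis using X x3 that x by (simp add: power2_eq_square)
  qed
  have nT: "2 * n x = N * fst (\<phi> x)" if "x \<in> X" for x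
    using tr[of "fst x" "snd x" z3 w3] x3 that unfolding \<phi>_def n_def
    by (cases x) auto
  have inj: "inj_on \<phi> X"
  proof (rule inj_onI)
    fix x y assume x: "x \<in> X" and y: "y \<in> X" and e: "\<phi> x = \<phi> y"
    have n: "n x = n y" using nT[OF x] nT[OF y] e by simp
    then have "D * (m x)^2 = D * (m y)^2" using nm[OF x] nm[OF y] unfolding n by linarith
    then have "(m x)^2 = (m y)^2" using D by simp
    then have "\<bar>m x\<bar> = \<bar>m y\<bar>" by (auto simp: power2_eq_iff)
    moreover have "sgn (m x) = sgn (m y)" using e by (simp add: \<phi>_def)
    ultimately have m: "m x = m y" by (metis sgn_mult_abs)
    obtain z w where xz: "x = (z, w)" by fastforce
    obtain z' w' where yz: "y = (z', w')" by fastforce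
    have N3: "N = z3^2 - D * w3^2" using X[OF x3] by simp
    have "z * N = z3 * n x - D * w3 * m x" "w * N = w3 * n x - z3 * m x"
      "z' * N = z3 * n y - D * w3 * m y" "w' * N = w3 * n y - z3 * m y"
      unfolding N3 n_def m_def xz yz by (simp_all add: power2_eq_square algebra_simps)
    then have "z * N = z' * N" "w * N = w' * N" using n m by simp_all
    then show "x = y" using N xz yz by simp
  qed
  have im: "\<phi> ` X \<subseteq> {-2..2} \<times> {-1, 0, 1}"
  proof
    fix p assume "p \<in> \<phi> ` X"
    then obtain x where x: "x \<in> X" "p = \<phi> x" by auto
    have "D * (m x)^2 \<le> 0" using D by (simp add: mult_le_0_iff)
    then have "(n x)^2 \<le> N^2" using nm[OF x(1)] by linarith
    then have "\<bar>n x\<bar> \<le> \<bar>N\<bar>" by (simp add: abs_le_square_iff)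
    then have "\<bar>N\<bar> * \<bar>fst (\<phi> x)\<bar> \<le> \<bar>N\<bar> * 2"
      using nT[OF x(1)] by (simp flip: abs_mult)
    then have "\<bar>fst (\<phi> x)\<bar> \<le> 2" using N by simp
    moreover have "snd (\<phi> x) \<in> {-1, 0, 1}" by (simp add: \<phi>_def sgn_if)
    ultimately show "p \<in> {-2..2} \<times> {-1, 0, 1}" using x(2) by (cases "\<phi> x") auto
  qed
  have fin: "finite ({-2..2} \<times> {-1, 0, 1} :: (int \<times> int) set)" by simp
  have "card X \<le> card ({-2..2} \<times> {-1, 0, 1} :: (int \<times> int) set)"
    by (rule card_inj_on_le[OF inj im fin])
  moreover have "finite X" by (rule inj_on_finite[OF inj im fin])
  ultimately show ?thesis by (simp add: card_cartesian_product)
qed simp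

text \<open>The unit quotient of two solutions has integral trace \<open>T\<close>; if it exceeds \<open>1\<close>, then
  \<open>T \<ge> 3\<close> and the quotient is at least \<open>2\<close>. So distinct solutions have dyadically separated values.\<close>

lemma norm_class_bound_pos:
  fixes D N :: int and B :: real
  assumes D: "D > 0" "real_of_int D \<le> B" and N: "N \<noteq> 0" and B: "B \<ge> 1"
    and X: "\<And>z w. (z, w) \<in> X \<Longrightarrow> z^2 - D * w^2 = N"
    and box: "\<And>z w. (z, w) \<in> X \<Longrightarrow> real_of_int \<bar>z\<bar> \<le> B \<and> real_of_int \<bar>w\<bar> \<le> B"
    and tr: "\<And>z w z' w'. (z, w) \<in> X \<Longrightarrow> (z', w') \<in> X \<Longrightarrow> N dvd 2 * (z * z' - D * w * w')"
  shows "finite X \<and> real (card X) \<le> 8 + 8 * log 2 B"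
proof -
  \<comment> \<open>A perfect square \<open>D\<close> needs no separate treatment: solutions are
    recovered from the pair \<open>(a x, a' x)\<close>, which requires only \<open>r > 0\<close>,
    not irrationality of \<open>r\<close>.\<close>
  define r where "r = sqrt (real_of_int D)"
  have r2: "r * r = real_of_int D" and r0: "r > 0" using D by (simp_all add: r_def)
  have "1 \<le> r" using D by (simp add: r_def)
  then have "r \<le> r * r" by simp
  then have rB: "r \<le> B" using r2 D by linarith
  define a where "a = (\<lambda>(z :: int, w :: int). real_of_int z + real_of_int w * r)"
  define a' where "a' = (\<lambda>(z :: int, w :: int). real_of_int z - real_of_int w * r)"
  have aa: "a x * a' x = real_of_int N" if "x \<in> X" for x
  proof -
    obtain z w where x: "x = (z, w)" by fastforce
    have "a x * a' x = real_of_int z^2 - r * r * real_of_int w^2"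
      unfolding a_def a'_def x by (simp add: power2_eq_square algebra_simps)
    also have "\<dots> = real_of_int (z^2 - D * w^2)" by (simp add: r2)
    also have "z^2 - D * w^2 = N" using X that x by simp
    finally show ?thesis .
  qed
  have ne: "a x \<noteq> 0" "a' x \<noteq> 0" if "x \<in> X" for x
    using aa[OF that] N by auto
  have bd: "\<bar>a x\<bar> \<le> 2 * B^2" "\<bar>a' x\<bar> \<le> 2 * B^2" if "x \<in> X" for x
  proof -
    obtain z w where x: "x = (z, w)" by fastforce
    have zw: "\<bar>real_of_int z\<bar> \<le> B" "\<bar>real_of_int w\<bar> \<le> B" using box that x by auto
    have "\<bar>real_of_int w * r\<bar> \<le> B * B"
      using zw r0 rB B unfolding abs_mult by (intro mult_mono) auto
    moreover have "B \<le> B * B" using B by simp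
    ultimately show "\<bar>a x\<bar> \<le> 2 * B^2" "\<bar>a' x\<bar> \<le> 2 * B^2"
      unfolding a_def a'_def x using zw by (auto simp: power2_eq_square)
  qed
  \<comment> \<open>The conjugate has the same upper bound, and the product of the two is a nonzero
    integer.\<close>
  have lower: "\<bar>a x\<bar> \<ge> 1 / (2 * B^2)" if "x \<in> X" for x
  proof -
    have "1 \<le> real_of_int \<bar>N\<bar>" using N by simp
    also have "\<dots> = \<bar>a x\<bar> * \<bar>a' x\<bar>" using aa[OF that] by (simp flip: abs_mult)
    also have "\<dots> \<le> \<bar>a x\<bar> * (2 * B^2)" using bd[OF that] by (intro mult_left_mono) auto
    finally show ?thesis using B by (simp add: field_simps)
  qed
  define l where "l = 1 + 2 * log 2 B"
  have l: "log 2 (2 * B^2) = l" using B by (simp add: l_def log_mult log_nat_power)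
  have lrange: "- l \<le> log 2 \<bar>a x\<bar>" "log 2 \<bar>a x\<bar> \<le> l" if "x \<in> X" for x
  proof -
    have "log 2 (1 / (2 * B^2)) = - l" using B l by (simp add: log_divide)
    moreover have "log 2 (1 / (2 * B^2)) \<le> log 2 \<bar>a x\<bar>"
      using lower[OF that] ne[OF that] B by (subst log_le_cancel_iff) auto
    ultimately show "- l \<le> log 2 \<bar>a x\<bar>" by simp
    show "log 2 \<bar>a x\<bar> \<le> l" unfolding l[symmetric]
      using bd[OF that] ne[OF that] B by (subst log_le_cancel_iff) auto
  qed
  define \<phi> where "\<phi> = (\<lambda>x. (\<lfloor>log 2 \<bar>a x\<bar>\<rfloor>, sgn (a x)))"
  have gap: "\<phi> x \<noteq> \<phi> y" if x: "x \<in> X" and y: "y \<in> X" and lt: "\<bar>a y\<bar> < \<bar>a x\<bar>" for x y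
  proof
    assume e: "\<phi> x = \<phi> y"
    define \<rho> where "\<rho> = a x / a y"
    have \<rho>1: "\<rho> > 1"
    proof -
      have "\<rho> = \<bar>a x\<bar> / \<bar>a y\<bar>"
        using e ne[OF x] ne[OF y] by (auto simp: \<phi>_def \<rho>_def sgn_if abs_if split: if_splits)
      then show ?thesis using lt ne[OF y] by simp
    qed
    obtain z w where xz: "x = (z, w)" by fastforce
    obtain z' w' where yz: "y = (z', w')" by fastforce
    obtain T where T: "2 * (z * z' - D * w * w') = N * T" using tr[of z w z' w'] x y xz yz by blast
    have "real_of_int N * (\<rho> + 1 / \<rho>) = a x * a' y + a y * a' x"
    proof -
      have "real_of_int N * \<rho> = a x * a' y"
        using ne[OF y] by (simp add: \<rho>_def flip: aa[OF y])
      moreover have "real_of_int N * (1 / \<rho>) = a y * a' x"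
        using ne[OF x] by (simp add: \<rho>_def flip: aa[OF x])
      ultimately show ?thesis by (simp add: distrib_left)
    qed
    also have "\<dots> = 2 * (real_of_int z * z' - r * r * w * w')"
      unfolding a_def a'_def xz yz by (simp add: algebra_simps)
    also have "\<dots> = real_of_int (2 * (z * z' - D * w * w'))" by (simp add: r2)
    also have "\<dots> = real_of_int N * real_of_int T" unfolding T by simp
    finally have \<rho>T: "\<rho> + 1 / \<rho> = real_of_int T" using N by simp
    have "(\<rho> - 1) * (\<rho> - 1) > 0" using \<rho>1 by simp
    then have "\<rho> * \<rho> + 1 > 2 * \<rho>" by (simp add: algebra_simps)
    then have "\<rho> + 1 / \<rho> > 2" using \<rho>1 by (simp add: field_simps)
    then have "T \<ge> 3" using \<rho>T by linarith
    moreover have "1 / \<rho> < 1" using \<rho>1 by simp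
    ultimately have \<rho>2: "\<rho> \<ge> 2" using \<rho>T by linarith
    have "\<bar>a x\<bar> = \<bar>\<rho>\<bar> * \<bar>a y\<bar>" using ne[OF y] by (simp add: \<rho>_def)
    then have "2 * \<bar>a y\<bar> \<le> \<bar>a x\<bar>" using \<rho>2 by (simp add: mult_right_mono)
    then have "log 2 (2 * \<bar>a y\<bar>) \<le> log 2 \<bar>a x\<bar>"
      using ne[OF x] ne[OF y] by (subst log_le_cancel_iff) auto
    then have "1 + log 2 \<bar>a y\<bar> \<le> log 2 \<bar>a x\<bar>" using ne[OF y] by (simp add: log_mult)
    then have "\<lfloor>log 2 \<bar>a y\<bar>\<rfloor> < \<lfloor>log 2 \<bar>a x\<bar>\<rfloor>" by linarith
    then show False using e by (simp add: \<phi>_def)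
  qed
  have inj: "inj_on \<phi> X"
  proof (rule inj_onI)
    fix x y assume x: "x \<in> X" and y: "y \<in> X" and e: "\<phi> x = \<phi> y"
    have "\<bar>a x\<bar> = \<bar>a y\<bar>"
      using gap[OF x y] gap[OF y x] e by (metis linorder_neqE)
    then have ax: "a x = a y" using e unfolding \<phi>_def by (metis prod.inject sgn_mult_abs)
    then have "a' x = a' y" using aa[OF x] aa[OF y] ne[OF y] by (metis mult_left_cancel)
    obtain z w where xz: "x = (z, w)" by fastforce
    obtain z' w' where yz: "y = (z', w')" by fastforce
    have "a x + a' x = a y + a' y" "a x - a' x = a y - a' y"
      using ax \<open>a' x = a' y\<close> by simp_all
    then have "z = z'" "w = w'" using r0 by (simp_all add: a_def a'_def xz yz)
    then show "x = y" by (simp add: xz yz)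
  qed
  let ?S = "{\<lfloor>- l\<rfloor>..\<lfloor>l\<rfloor>} \<times> {-1, 1 :: real}"
  have im: "\<phi> ` X \<subseteq> ?S"
  proof
    fix p assume "p \<in> \<phi> ` X"
    then obtain x where x: "x \<in> X" "p = \<phi> x" by auto
    show "p \<in> ?S" unfolding x(2) \<phi>_def using lrange[OF x(1)] ne[OF x(1)]
      by (auto simp: sgn_if intro: floor_mono)
  qed
  have fin: "finite ?S" by simp
  have "card X \<le> card ?S" by (rule card_inj_on_le[OF inj im fin])
  moreover have "finite X" by (rule inj_on_finite[OF inj im fin])
  \<comment> \<open>At most \<open>2 * l + 2\<close> floors and two signs: \<open>4 * l + 4\<close>
    with \<open>l = 1 + 2 * log 2 B\<close>.\<close>
  moreover have "real (card ?S) \<le> 8 + 8 * log 2 B"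
  proof -
    have "log 2 B \<ge> 0" using B by simp
    then have "\<lfloor>- l\<rfloor> \<le> \<lfloor>l\<rfloor>" by (intro floor_mono) (simp add: l_def)
    then have "real (nat (\<lfloor>l\<rfloor> - \<lfloor>- l\<rfloor> + 1)) = real_of_int (\<lfloor>l\<rfloor> - \<lfloor>- l\<rfloor> + 1)" by simp
    moreover have "real_of_int (\<lfloor>l\<rfloor> - \<lfloor>- l\<rfloor> + 1) \<le> 2 * l + 2" by linarith
    ultimately show ?thesis by (simp add: card_cartesian_product l_def)
  qed
  ultimately show ?thesis by (meson of_nat_mono order_trans)
qed

section \<open>Summation over the classes of solutions in a box\<close>

definition norm_sols :: "int \<Rightarrow> int \<Rightarrow> real \<Rightarrow> (int \<times> int) set" where
  "norm_sols D N B = {(z, w). z^2 - D * w^2 = N \<and> real_of_int \<bar>z\<bar> \<le> B \<and> real_of_int \<bar>w\<bar> \<le> B}"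

lemma finite_int_abs_le: "finite {z::int. real_of_int \<bar>z\<bar> \<le> B}"
proof (rule finite_subset)
  show "{z::int. real_of_int \<bar>z\<bar> \<le> B} \<subseteq> {- \<lfloor>B\<rfloor>..\<lfloor>B\<rfloor>}"
    by (auto simp: le_floor_iff abs_le_iff minus_le_iff)
qed simp

lemma finite_norm_sols: "finite (norm_sols D N B)"
proof (rule finite_subset)
  show "norm_sols D N B \<subseteq> {z. real_of_int \<bar>z\<bar> \<le> B} \<times> {z. real_of_int \<bar>z\<bar> \<le> B}"
    by (auto simp: norm_sols_def)
qed (intro finite_cartesian_product finite_int_abs_le)

text \<open>Relative to one fixed solution there is at most one class per divisor of
  \<open>N\<close>, and within a class \<open>trace_integral\<close> supplies the trace condition.
  The constant 15 covers both signs of \<open>D\<close>.\<close>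

lemma coprime_norm_sols_bound:
  fixes D N :: int and B :: real
  assumes D: "D \<noteq> 0" "real_of_int D \<le> B" and N: "N \<noteq> 0" and B: "B \<ge> 1"
  shows "real (card {(z, w) \<in> norm_sols D N B. coprime z w})
    \<le> real (ndiv (nat \<bar>N\<bar>)) * (15 + 8 * log 2 B)"
proof -
  define S where "S = {(z, w) \<in> norm_sols D N B. coprime z w}"
  have lB: "log 2 B \<ge> 0" using B by simp
  show ?thesis
  proof (cases "S = {}")
    case False
    then obtain z1 w1 where 1: "(z1, w1) \<in> S" by auto
    define X where "X = (\<lambda>k. {(z, w) \<in> S. gcd N (z1 * w - z * w1) = int k})"
    have cls: "real (card (X k)) \<le> 15 + 8 * log 2 B" for k
    proof -
      have eq: "z^2 - D * w^2 = N" if "(z, w) \<in> X k" for z w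
        using that by (simp add: X_def S_def norm_sols_def)
      have bx: "real_of_int \<bar>z\<bar> \<le> B \<and> real_of_int \<bar>w\<bar> \<le> B" if "(z, w) \<in> X k" for z w
        using that by (simp add: X_def S_def norm_sols_def)
      have tr: "N dvd 2 * (z * z' - D * w * w')" if "(z, w) \<in> X k" "(z', w') \<in> X k" for z w z' w'
        using that 1 N unfolding X_def S_def norm_sols_def
        by (intro trace_integral[of z1 D w1 N z w z' w' "int k"]) simp_all
      show ?thesis
      proof (cases "D > 0")
        case True
        then show ?thesis
          using norm_class_bound_pos[of D B N "X k"] D N B eq bx tr by fastforce
      next
        case False
        then have "D < 0" using D by simp
        then have "card (X k) \<le> 15"
          using norm_class_bound_neg[of D N "X k"] N eq tr by blast
        then show ?thesis using lB by simp
      qed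
    qed
    let ?d = "{d. d dvd nat \<bar>N\<bar>}"
    have fd: "finite ?d" using N by (intro finite_divisors_pos) simp
    have "x \<in> (\<Union>k\<in>?d. X k)" if x: "x \<in> S" for x
    proof -
      obtain z w where zw: "x = (z, w)" by fastforce
      let ?g = "gcd N (z1 * w - z * w1)"
      have "nat ?g dvd nat \<bar>N\<bar>" by (simp add: nat_dvd_iff)
      moreover have "x \<in> X (nat ?g)" using x by (simp add: X_def zw)
      ultimately show ?thesis by blast
    qed
    then have "S \<subseteq> (\<Union>k\<in>?d. X k)" by blast
    moreover have fS: "finite S"
      unfolding S_def by (rule finite_subset[OF _ finite_norm_sols[of D N B]]) auto
    moreover have "\<And>k. finite (X k)"
      unfolding X_def by (rule finite_subset[OF _ fS]) auto
    ultimately have "card S \<le> card (\<Union>k\<in>?d. X k)"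
      using fd by (intro card_mono) auto
    also have "\<dots> \<le> (\<Sum>k\<in>?d. card (X k))" by (rule card_UN_le[OF fd])
    finally have "real (card S) \<le> (\<Sum>k\<in>?d. real (card (X k)))"
      by (metis of_nat_mono of_nat_sum)
    also have "\<dots> \<le> (\<Sum>k\<in>?d. 15 + 8 * log 2 B)" by (intro sum_mono cls)
    also have "\<dots> = real (ndiv (nat \<bar>N\<bar>)) * (15 + 8 * log 2 B)" by (simp add: ndiv_def)
    finally show ?thesis by (simp add: S_def)
  next
    case True
    then show ?thesis unfolding S_def[symmetric] using lB by simp
  qed
qed

text \<open>Dividing by \<open>g = gcd z w\<close> leaves a coprime solution for
  \<open>N / g^2\<close>. Summing over the divisors \<open>g\<close> of \<open>N\<close> costs the
  second factor \<open>ndiv\<close>.\<close>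

lemma norm_sols_bound:
  fixes D N :: int and B :: real
  assumes D: "D \<noteq> 0" "real_of_int D \<le> B" and N: "N \<noteq> 0" and B: "B \<ge> 1"
  shows "real (card (norm_sols D N B)) \<le> real (ndiv (nat \<bar>N\<bar>))^2 * (15 + 8 * log 2 B)"
proof -
  have lB: "log 2 B \<ge> 0" using B by simp
  let ?d = "{d. d dvd nat \<bar>N\<bar>}"
  have fd: "finite ?d" using N by (intro finite_divisors_pos) simp
  define Y where "Y = (\<lambda>g. {(z, w) \<in> norm_sols D N B. nat (gcd z w) = g})"
  have gN: "(gcd z w)^2 dvd N" if "(z, w) \<in> norm_sols D N B" for z w
  proof -
    have "(gcd z w)^2 dvd z^2" "(gcd z w)^2 dvd w^2" by (simp_all add: dvd_power_same)
    then have "(gcd z w)^2 dvd z^2 - D * w^2" by (intro dvd_diff dvd_mult)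
    moreover have "z^2 - D * w^2 = N" using that by (simp add: norm_sols_def)
    ultimately show ?thesis by simp
  qed
  have "norm_sols D N B \<subseteq> (\<Union>g\<in>?d. Y g)"
  proof
    fix x assume x: "x \<in> norm_sols D N B"
    obtain z w where zw: "x = (z, w)" by fastforce
    have "gcd z w dvd N" using gN[of z w] x zw by (metis dvd_power_iff dvd_trans dvd_triv_left power2_eq_square)
    then have "nat (gcd z w) dvd nat \<bar>N\<bar>" by (simp add: nat_dvd_iff)
    then show "x \<in> (\<Union>g\<in>?d. Y g)" using x zw by (auto simp: Y_def)
  qed
  moreover have finY: "\<And>g. finite (Y g)"
    unfolding Y_def by (rule finite_subset[OF _ finite_norm_sols[of D N B]]) auto
  ultimately have "card (norm_sols D N B) \<le> card (\<Union>g\<in>?d. Y g)"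
    using fd by (intro card_mono) auto
  also have "\<dots> \<le> (\<Sum>g\<in>?d. card (Y g))" by (rule card_UN_le[OF fd])
  finally have "real (card (norm_sols D N B)) \<le> (\<Sum>g\<in>?d. real (card (Y g)))"
    by (metis of_nat_mono of_nat_sum)
  also have "\<dots> \<le> (\<Sum>g\<in>?d. real (ndiv (nat \<bar>N\<bar>)) * (15 + 8 * log 2 B))"
  proof (rule sum_mono)
    fix g assume g: "g \<in> ?d"
    show "real (card (Y g)) \<le> real (ndiv (nat \<bar>N\<bar>)) * (15 + 8 * log 2 B)"
    proof (cases "Y g = {}")
      case False
      then obtain z0 w0 where z0: "(z0, w0) \<in> norm_sols D N B" "nat (gcd z0 w0) = g"
        by (auto simp: Y_def)
      have g0: "g > 0" using g N by (auto intro: ccontr)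
      have "(int g)^2 dvd N" using gN[OF z0(1)] z0(2) by auto
      then obtain N' where N': "N = (int g)^2 * N'" by blast
      have N'0: "N' \<noteq> 0" using N N' by auto
      let ?Z = "{(z, w) \<in> norm_sols D N' B. coprime z w}"
      have fZ: "finite ?Z" by (rule finite_subset[OF _ finite_norm_sols[of D N' B]]) auto
      have "Y g \<subseteq> (\<lambda>(z, w). (int g * z, int g * w)) ` ?Z"
      proof
        fix x assume x: "x \<in> Y g"
        obtain z w where xz: "x = (z, w)" by fastforce
        have gg: "gcd z w = int g" and zw: "(z, w) \<in> norm_sols D N B"
          using x xz by (auto simp: Y_def)
        obtain z' where z': "z = int g * z'" using gg by (metis dvdE gcd_dvd1)
        obtain w' where w': "w = int g * w'" using gg by (metis dvdE gcd_dvd2)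
        have "int g * gcd z' w' = int g"
          using gg gcd_mult_distrib_int[of "int g" z' w'] unfolding z' w' by simp
        then have "coprime z' w'" using g0 by (simp add: coprime_iff_gcd_eq_1)
        moreover have "(int g)^2 * (z'^2 - D * w'^2) = (int g)^2 * N'"
          using zw unfolding N'[symmetric] z' w' norm_sols_def
          by (simp add: power_mult_distrib algebra_simps)
        then have "z'^2 - D * w'^2 = N'" using g0 by simp
        moreover have le: "real_of_int \<bar>u\<bar> \<le> B" if "real_of_int \<bar>int g * u\<bar> \<le> B" for u
        proof -
          have "\<bar>u\<bar> \<le> int g * \<bar>u\<bar>" using g0 by (simp add: mult_le_cancel_right1)
          then have "\<bar>u\<bar> \<le> \<bar>int g * u\<bar>" by (simp add: abs_mult)
          then have "real_of_int \<bar>u\<bar> \<le> real_of_int \<bar>int g * u\<bar>" by (rule of_int_le_iff[THEN iffD2])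
          with that show ?thesis by linarith
        qed
        have "real_of_int \<bar>z'\<bar> \<le> B" "real_of_int \<bar>w'\<bar> \<le> B"
          using zw le unfolding z' w' norm_sols_def
          by (simp_all only: mem_Collect_eq case_prod_conv)
        ultimately have "(z', w') \<in> ?Z" by (simp add: norm_sols_def)
        then show "x \<in> (\<lambda>(z, w). (int g * z, int g * w)) ` ?Z"
          unfolding xz z' w' by (rule rev_image_eqI) simp
      qed
      then have "card (Y g) \<le> card ?Z" by (rule surj_card_le[OF fZ])
      then have "real (card (Y g)) \<le> real (card ?Z)" by simp
      also have "\<dots> \<le> real (ndiv (nat \<bar>N'\<bar>)) * (15 + 8 * log 2 B)"
        by (rule coprime_norm_sols_bound[OF D N'0 B])
      also have "\<dots> \<le> real (ndiv (nat \<bar>N\<bar>)) * (15 + 8 * log 2 B)"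
      proof -
        have "nat \<bar>N'\<bar> dvd nat \<bar>N\<bar>" unfolding N' by (simp add: abs_mult nat_mult_distrib)
        then have "ndiv (nat \<bar>N'\<bar>) \<le> ndiv (nat \<bar>N\<bar>)" using N by (intro ndiv_dvd_mono) auto
        then show ?thesis using lB by (intro mult_right_mono) auto
      qed
      finally show ?thesis .
    qed (use lB in simp)
  qed
  also have "\<dots> = real (ndiv (nat \<bar>N\<bar>))^2 * (15 + 8 * log 2 B)"
    by (simp add: ndiv_def power2_eq_square)
  finally show ?thesis .
qed

section \<open>Binary quadratic forms\<close>

lemma norm_sols_bound_powr:
  fixes \<epsilon> :: real
  assumes e: "\<epsilon> > 0"
  shows "\<exists>K\<ge>0. \<forall>D N B. D \<noteq> 0 \<longrightarrow> N \<noteq> 0 \<longrightarrow> B \<ge> 1 \<longrightarrow> real_of_int \<bar>D\<bar> \<le> B \<longrightarrow>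
    real (card (norm_sols D N B)) \<le> K * B powr \<epsilon>"
proof -
  \<comment> \<open>A solution exists only for \<open>N\<close> of size at most
    \<open>2 * B^3\<close>, so the squared divisor count costs \<open>6 * \<delta>\<close> and the
    logarithm one more \<delta>.\<close>
  define \<delta> where "\<delta> = \<epsilon> / 7"
  have d: "\<delta> > 0" using e by (simp add: \<delta>_def)
  obtain k where k: "k \<ge> 1" "\<And>n. n > 0 \<Longrightarrow> real (ndiv n) \<le> k * real n powr \<delta>"
    using divisor_bound[OF d] by blast
  define k2 where "k2 = 15 + 8 / (\<delta> * ln 2)"
  define K where "K = (k * 2 powr \<delta>)^2 * k2"
  have k2: "k2 \<ge> 0" using d by (simp add: k2_def)
  have "real (card (norm_sols D N B)) \<le> K * B powr \<epsilon>"
    if D: "D \<noteq> 0" and N: "N \<noteq> 0" and B: "B \<ge> 1" and DB: "real_of_int \<bar>D\<bar> \<le> B" for D N B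
  proof (cases "norm_sols D N B = {}")
    case False
    then obtain z w where zw: "z^2 - D * w^2 = N" "real_of_int \<bar>z\<bar> \<le> B" "real_of_int \<bar>w\<bar> \<le> B"
      by (auto simp: norm_sols_def)
    have "real_of_int \<bar>N\<bar> \<le> real_of_int \<bar>z\<bar>^2 + real_of_int \<bar>D\<bar> * real_of_int \<bar>w\<bar>^2"
    proof -
      have "\<bar>N\<bar> \<le> \<bar>z^2\<bar> + \<bar>D * w^2\<bar>" unfolding zw(1)[symmetric] by (rule abs_triangle_ineq4)
      also have "\<dots> = \<bar>z\<bar>^2 + \<bar>D\<bar> * \<bar>w\<bar>^2" by (simp add: abs_mult)
      finally have "real_of_int \<bar>N\<bar> \<le> real_of_int (\<bar>z\<bar>^2 + \<bar>D\<bar> * \<bar>w\<bar>^2)" by (rule of_int_le_iff[THEN iffD2])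
      then show ?thesis by simp
    qed
    also have "\<dots> \<le> B^2 + B * B^2"
      using zw DB B by (intro add_mono mult_mono power_mono) auto
    also have "\<dots> \<le> 2 * B^3"
      using B power_increasing[of 2 3 B] by (simp add: power3_eq_cube power2_eq_square)
    finally have NB: "real_of_int \<bar>N\<bar> \<le> 2 * B^3" .
    have t: "real (ndiv (nat \<bar>N\<bar>)) \<le> k * 2 powr \<delta> * B powr (3 * \<delta>)"
    proof -
      have "real (ndiv (nat \<bar>N\<bar>)) \<le> k * real (nat \<bar>N\<bar>) powr \<delta>" using N by (intro k(2)) simp
      also have "\<dots> \<le> k * (2 * B^3) powr \<delta>"
        using NB k(1) d by (intro mult_left_mono powr_mono2) auto
      also have "(2 * B^3) powr \<delta> = 2 powr \<delta> * B powr (3 * \<delta>)"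
      proof -
        have "B^3 = B powr 3" using B powr_realpow[of B 3] by simp
        then have "(B^3) powr \<delta> = B powr (3 * \<delta>)" by (simp only: powr_powr)
        then show ?thesis using B by (simp add: powr_mult)
      qed
      finally show ?thesis by simp
    qed
    have l: "15 + 8 * log 2 B \<le> k2 * B powr \<delta>"
    proof -
      have "ln B \<le> B powr \<delta> / \<delta>" using ln_powr_bound[OF B d] .
      then have "log 2 B \<le> B powr \<delta> / \<delta> / ln 2" 
        unfolding log_def by (rule divide_right_mono) simp
      moreover have "1 \<le> B powr \<delta>" using B d by (simp add: ge_one_powr_ge_zero)
      ultimately have "15 + 8 * log 2 B \<le> 15 * B powr \<delta> + 8 * (B powr \<delta> / \<delta> / ln 2)"
        by linarith
      also have "\<dots> = k2 * B powr \<delta>" using d by (simp add: k2_def field_simps)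
      finally show ?thesis .
    qed
    have "real (card (norm_sols D N B)) \<le> real (ndiv (nat \<bar>N\<bar>))^2 * (15 + 8 * log 2 B)"
      using DB by (intro norm_sols_bound D N B) linarith
    also have "\<dots> \<le> (k * 2 powr \<delta> * B powr (3 * \<delta>))^2 * (k2 * B powr \<delta>)"
      using t l B by (intro mult_mono power_mono) auto
    also have "\<dots> = K * (B powr (3 * \<delta>) * B powr (3 * \<delta>) * B powr \<delta>)"
      by (simp add: K_def power2_eq_square algebra_simps)
    also have "B powr (3 * \<delta>) * B powr (3 * \<delta>) * B powr \<delta> = B powr \<epsilon>"
      by (simp flip: powr_add) (simp add: \<delta>_def)
    finally show ?thesis .
  qed (use k2 in \<open>simp add: K_def\<close>)
  moreover have "K \<ge> 0" using k2 by (simp add: K_def)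
  ultimately show ?thesis by blast
qed

text \<open>The middle coefficient is \<open>2 * b\<close>, so that \<open>a\<close>,
  \<open>b\<close>, \<open>c\<close> are the entries of a symmetric matrix and
  \<open>a * c - b^2\<close> is its determinant.\<close>

definition binform_sols :: "int \<Rightarrow> int \<Rightarrow> int \<Rightarrow> int \<Rightarrow> real \<Rightarrow> (int \<times> int) set" where
  "binform_sols a b c N B = {(z, w). a * z^2 + 2 * b * z * w + c * w^2 = N \<and>
     real_of_int \<bar>z\<bar> \<le> B \<and> real_of_int \<bar>w\<bar> \<le> B}"

lemma finite_binform_sols: "finite (binform_sols a b c N B)"
proof (rule finite_subset)
  show "binform_sols a b c N B \<subseteq> {z. real_of_int \<bar>z\<bar> \<le> B} \<times> {z. real_of_int \<bar>z\<bar> \<le> B}"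
    by (auto simp: binform_sols_def)
qed (intro finite_cartesian_product finite_int_abs_le)

lemma real_abs_mult_le:
  assumes "real_of_int \<bar>x\<bar> \<le> B" "real_of_int \<bar>y\<bar> \<le> B'"
  shows "real_of_int \<bar>x * y\<bar> \<le> B * B'"
proof -
  have "real_of_int \<bar>x * y\<bar> = real_of_int \<bar>x\<bar> * real_of_int \<bar>y\<bar>" by (simp add: abs_mult)
  also have "\<dots> \<le> B * B'" using assms order_trans[OF _ assms(1)] by (intro mult_mono) auto
  finally show ?thesis .
qed

text \<open>Multiplication by \<open>a\<close> completes the square:
  \<open>(a * z + b * w)^2 - (b^2 - a * c) * w^2 = a * N\<close>.\<close>

lemma binform_sols_card_le_norm_sols:
  assumes a: "a \<noteq> 0" and B: "B \<ge> 1"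
    and ab: "real_of_int \<bar>a\<bar> \<le> B" "real_of_int \<bar>b\<bar> \<le> B"
  shows "card (binform_sols a b c N B) \<le> card (norm_sols (b^2 - a * c) (a * N) (2 * B^2))"
proof (rule card_inj_on_le)
  show "inj_on (\<lambda>(z, w). (a * z + b * w, w)) (binform_sols a b c N B)"
    using a by (auto simp: inj_on_def)
  show "(\<lambda>(z, w). (a * z + b * w, w)) ` binform_sols a b c N B
      \<subseteq> norm_sols (b^2 - a * c) (a * N) (2 * B^2)"
  proof clarify
    fix z w assume "(z, w) \<in> binform_sols a b c N B"
    then have eq: "a * z^2 + 2 * b * z * w + c * w^2 = N"
      and z: "real_of_int \<bar>z\<bar> \<le> B" and w: "real_of_int \<bar>w\<bar> \<le> B"
      by (auto simp: binform_sols_def)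
    have "(a * z + b * w)^2 - (b^2 - a * c) * w^2 = a * N"
      unfolding eq[symmetric] by (simp add: power2_eq_square algebra_simps)
    moreover have "real_of_int \<bar>a * z + b * w\<bar> \<le> 2 * B^2"
      using real_abs_mult_le[OF ab(1) z] real_abs_mult_le[OF ab(2) w]
      by (simp add: power2_eq_square)
    moreover have "B \<le> B^2" using B by (simp add: power2_eq_square)
    then have "real_of_int \<bar>w\<bar> \<le> 2 * B^2" using w B by linarith
    ultimately show "(a * z + b * w, w) \<in> norm_sols (b^2 - a * c) (a * N) (2 * B^2)"
      by (simp add: norm_sols_def)
  qed
qed (rule finite_norm_sols)

lemma binform_sols_swap: "card (binform_sols a b c N B) = card (binform_sols c b a N B)"
proof (rule bij_betw_same_card)
  show "bij_betw (\<lambda>(z, w). (w, z)) (binform_sols a b c N B) (binform_sols c b a N B)"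
    by (rule bij_betwI[where g = "\<lambda>(z, w). (w, z)"]) (auto simp: binform_sols_def algebra_simps)
qed

text \<open>Without diagonal coefficients there is no square to complete. The shear
  \<open>w = z + w'\<close> creates the leading coefficient \<open>2 * b\<close>, at the price of
  doubling the box.\<close>

lemma binform_sols_hyperbolic:
  "card (binform_sols 0 b 0 N B) \<le> card (binform_sols (2 * b) b 0 N (2 * B))"
proof (rule card_inj_on_le)
  show "inj_on (\<lambda>(z, w). (z, w - z)) (binform_sols 0 b 0 N B)" by (auto simp: inj_on_def)
  show "(\<lambda>(z, w). (z, w - z)) ` binform_sols 0 b 0 N B \<subseteq> binform_sols (2 * b) b 0 N (2 * B)"
    by (auto simp: binform_sols_def power2_eq_square algebra_simps)
qed (rule finite_binform_sols)

lemma binform_sols_bound: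
  fixes \<epsilon> :: real
  assumes e: "\<epsilon> > 0"
  shows "\<exists>K\<ge>0. \<forall>a b c N B. a * c - b^2 \<noteq> 0 \<longrightarrow> N \<noteq> 0 \<longrightarrow> B \<ge> 1 \<longrightarrow>
    real_of_int \<bar>a\<bar> \<le> B \<longrightarrow> real_of_int \<bar>b\<bar> \<le> B \<longrightarrow> real_of_int \<bar>c\<bar> \<le> B \<longrightarrow>
    real (card (binform_sols a b c N B)) \<le> K * B powr \<epsilon>"
proof -
  \<comment> \<open>The norm equation lives in a box of size \<open>2 * B^2\<close>, hence half of
    \<epsilon>.\<close>
  obtain k where k: "k \<ge> 0" and nb: "\<And>D N B. D \<noteq> 0 \<Longrightarrow> N \<noteq> 0 \<Longrightarrow> B \<ge> 1 \<Longrightarrow>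
      real_of_int \<bar>D\<bar> \<le> B \<Longrightarrow> real (card (norm_sols D N B)) \<le> k * B powr (\<epsilon> / 2)"
    using norm_sols_bound_powr[of "\<epsilon> / 2"] e by auto
  define k' where "k' = k * 2 powr (\<epsilon> / 2)"
  have k': "k' \<ge> 0" using k by (simp add: k'_def)
  have main: "real (card (binform_sols a b c N B)) \<le> k' * B powr \<epsilon>"
    if a: "a \<noteq> 0" and "a * c - b^2 \<noteq> 0" "N \<noteq> 0" and B: "B \<ge> 1" and
      ab: "real_of_int \<bar>a\<bar> \<le> B" "real_of_int \<bar>b\<bar> \<le> B" and c: "real_of_int \<bar>c\<bar> \<le> B"
    for a b c N B
  proof -
    have "real (card (binform_sols a b c N B)) \<le> real (card (norm_sols (b^2 - a * c) (a * N) (2 * B^2)))"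
      using binform_sols_card_le_norm_sols[OF a B ab] by simp
    also have "\<dots> \<le> k * (2 * B^2) powr (\<epsilon> / 2)"
    proof (rule nb)
      have "real_of_int \<bar>b^2 - a * c\<bar> \<le> real_of_int \<bar>b * b\<bar> + real_of_int \<bar>a * c\<bar>"
        unfolding of_int_add[symmetric] of_int_le_iff power2_eq_square by (rule abs_triangle_ineq4)
      also have "\<dots> \<le> 2 * B^2"
        using real_abs_mult_le[OF ab(2) ab(2)] real_abs_mult_le[OF ab(1) c]
        unfolding power2_eq_square by linarith
      finally show "real_of_int \<bar>b^2 - a * c\<bar> \<le> 2 * B^2" .
      have "1 \<le> B^2" using B by (rule one_le_power)
      then show "2 * B^2 \<ge> 1" by linarith
    qed (use that in auto)
    also have "\<dots> = k' * B powr \<epsilon>"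
    proof -
      have "B^2 = B powr 2" using B powr_realpow[of B 2] by simp
      then have "(B^2) powr (\<epsilon> / 2) = B powr \<epsilon>" by (simp only: powr_powr) simp
      then show ?thesis using B by (simp add: k'_def powr_mult)
    qed
    finally show ?thesis .
  qed
  \<comment> \<open>The extra factor pays for the doubled box of the hyperbolic case.\<close>
  define K where "K = k' * 2 powr \<epsilon>"
  have "1 \<le> 2 powr \<epsilon>" using e by (simp add: ge_one_powr_ge_zero)
  then have kK: "k' \<le> K" unfolding K_def using k' by (simp add: mult_le_cancel_left1)
  have "real (card (binform_sols a b c N B)) \<le> K * B powr \<epsilon>"
    if h: "a * c - b^2 \<noteq> 0" "N \<noteq> 0" "B \<ge> 1" "real_of_int \<bar>a\<bar> \<le> B" "real_of_int \<bar>b\<bar> \<le> B"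
      "real_of_int \<bar>c\<bar> \<le> B" for a b c N B
  proof -
    have up: "k' * B powr \<epsilon> \<le> K * B powr \<epsilon>" using kK by (intro mult_right_mono) auto
    consider "a \<noteq> 0" | "c \<noteq> 0" | "a = 0" "c = 0" by blast
    then show ?thesis
    proof cases
      case 1
      then show ?thesis using main[of a c b N B] h up by linarith
    next
      case 2
      then have "real (card (binform_sols c b a N B)) \<le> k' * B powr \<epsilon>"
        using h by (intro main) (auto simp: mult.commute)
      then show ?thesis using binform_sols_swap[of a b c N B] up by linarith
    next
      case 3
      then have b: "b \<noteq> 0" using h by auto
      have "real (card (binform_sols a b c N B)) \<le> real (card (binform_sols (2 * b) b 0 N (2 * B)))"
        using 3 binform_sols_hyperbolic by simp
      also have "\<dots> \<le> k' * (2 * B) powr \<epsilon>" using b h by (intro main) auto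
      also have "\<dots> = K * B powr \<epsilon>" using h by (simp add: K_def powr_mult)
      finally show ?thesis .
    qed
  qed
  moreover have "K \<ge> 0" using k' by (simp add: K_def)
  ultimately show ?thesis by blast
qed

section \<open>Points of a box on lines and quadrics\<close>

definition box :: "'i set \<Rightarrow> nat \<Rightarrow> ('i \<Rightarrow> int) set" where
  "box J R = J \<rightarrow>\<^sub>E {- int R..int R}"

lemma finite_box: "finite J \<Longrightarrow> finite (box J R)"
  unfolding box_def by (intro finite_PiE) auto

lemma card_box: "finite J \<Longrightarrow> card (box J R) = (2 * R + 1) ^ card J"
proof -
  assume J: "finite J"
  have "card {- int R..int R} = 2 * R + 1" unfolding card_atLeastAtMost_int by linarith
  with J show ?thesis unfolding box_def by (subst card_PiE) simp_all
qed

lemma box_abs_le: "x \<in> box J R \<Longrightarrow> i \<in> J \<Longrightarrow> \<bar>x i\<bar> \<le> int R"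
  unfolding box_def by (auto dest!: PiE_mem simp: abs_le_iff)

lemma box_ext: "x \<in> box J R \<Longrightarrow> y \<in> box J R \<Longrightarrow> (\<And>i. i \<in> J \<Longrightarrow> x i = y i) \<Longrightarrow> x = y"
  unfolding box_def by (rule PiE_ext)

lemma restrict_in_box: "(\<And>i. i \<in> J \<Longrightarrow> \<bar>f i\<bar> \<le> int R) \<Longrightarrow> restrict f J \<in> box J R"
  unfolding box_def by (auto simp: abs_le_iff minus_le_iff)

lemma card_fibres_le:
  assumes "finite S" "\<And>y. y \<in> f ` S \<Longrightarrow> real (card {x \<in> S. f x = y}) \<le> d"
  shows "real (card S) \<le> d * real (card (f ` S))"
proof -
  have "card S = (\<Sum>y\<in>f ` S. card {x \<in> S. f x = y})"
    using sum.image_gen[OF assms(1), of "\<lambda>_. 1::nat" f] by simp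
  then have "real (card S) = (\<Sum>y\<in>f ` S. real (card {x \<in> S. f x = y}))" by simp
  also have "\<dots> \<le> (\<Sum>y\<in>f ` S. d)" by (intro sum_mono assms(2))
  finally show ?thesis by (simp add: mult.commute)
qed

text \<open>A set meeting each line in direction \<open>v\<close> in at most \<open>d\<close> points. The map
  \<open>x \<mapsto> v\<^sub>j x - x\<^sub>j v\<close> forgets the coordinate \<open>j\<close> and is constant exactly on these lines.\<close>

lemma card_box_line_le:
  fixes S :: "('i \<Rightarrow> int) set"
  assumes J: "finite J" "j \<in> J" and S: "S \<subseteq> box J R"
    and v: "v j \<noteq> 0" "\<And>i. i \<in> J \<Longrightarrow> \<bar>v i\<bar> \<le> int b"
    and p: "\<And>x. x \<in> S \<Longrightarrow> \<exists>p :: int poly. p \<noteq> 0 \<and> degree p \<le> d \<and>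
      (\<forall>y\<in>S. (\<forall>i\<in>J. v j * (y i - x i) = (y j - x j) * v i) \<longrightarrow> poly p (y j - x j) = 0)"
  shows "card S \<le> d * (4 * b * R + 1) ^ (card J - 1)"
proof -
  define f where "f = (\<lambda>x :: 'i \<Rightarrow> int. restrict (\<lambda>i. v j * x i - x j * v i) (J - {j}))"
  have fS: "finite S" using S finite_box[OF J(1)] by (rule finite_subset)
  have "real (card {x \<in> S. f x = y}) \<le> real d" if y: "y \<in> f ` S" for y
  proof -
    obtain x where x: "x \<in> S" "f x = y" using y by auto
    obtain p :: "int poly" where p0: "p \<noteq> 0" "degree p \<le> d" and
      pz: "\<And>y. y \<in> S \<Longrightarrow> (\<And>i. i \<in> J \<Longrightarrow> v j * (y i - x i) = (y j - x j) * v i) \<Longrightarrow> poly p (y j - x j) = 0"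
      using p[OF x(1)] by blast
    have ln: "v j * (z i - x i) = (z j - x j) * v i" if "z \<in> S" "f z = y" "i \<in> J" for z i
    proof (cases "i = j")
      case False
      have "f z i = f x i" using that x by simp
      then show ?thesis using False that(3) by (simp add: f_def algebra_simps)
    qed simp
    have "card {z \<in> S. f z = y} \<le> card {r. poly p r = 0}"
    proof (rule card_inj_on_le)
      show "inj_on (\<lambda>z. z j - x j) {z \<in> S. f z = y}"
      proof (rule inj_onI)
        fix z z' assume z: "z \<in> {z \<in> S. f z = y}" and z': "z' \<in> {z \<in> S. f z = y}"
          and e: "z j - x j = z' j - x j"
        have "z i = z' i" if "i \<in> J" for i
        proof -
          have "v j * (z i - x i) = v j * (z' i - x i)"
            using ln[of z i] ln[of z' i] z z' that e by simp
          then show ?thesis using v by simp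
        qed
        then show "z = z'" using z z' S by (intro box_ext[of z J R z']) auto
      qed
      show "(\<lambda>z. z j - x j) ` {z \<in> S. f z = y} \<subseteq> {r. poly p r = 0}"
        using pz ln by auto
      show "finite {r. poly p r = 0}" using p0 by (rule_tac poly_roots_finite)
    qed
    also have "\<dots> \<le> degree p" by (rule card_poly_roots_bound[OF p0(1)])
    finally show ?thesis using p0(2) by simp
  qed
  then have "real (card S) \<le> real d * real (card (f ` S))" by (rule card_fibres_le[OF fS])
  then have "card S \<le> d * card (f ` S)" by (simp flip: of_nat_mult)
  also have "card (f ` S) \<le> card (box (J - {j}) (2 * b * R))"
  proof (rule card_mono[OF finite_box])
    show "f ` S \<subseteq> box (J - {j}) (2 * b * R)"
    proof clarify
      fix x assume x: "x \<in> S"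
      show "f x \<in> box (J - {j}) (2 * b * R)" unfolding f_def
      proof (rule restrict_in_box)
        fix i assume i: "i \<in> J - {j}"
        have "\<bar>v j * x i - x j * v i\<bar> \<le> \<bar>v j\<bar> * \<bar>x i\<bar> + \<bar>x j\<bar> * \<bar>v i\<bar>"
          using abs_triangle_ineq4[of "v j * x i" "x j * v i"] by (simp add: abs_mult)
        also have "\<dots> \<le> int b * int R + int R * int b"
          using v(2) J(2) i x S by (intro add_mono mult_mono) (auto intro: box_abs_le)
        finally show "\<bar>v j * x i - x j * v i\<bar> \<le> int (2 * b * R)" by (simp add: mult_ac)
      qed
    qed
  qed (use J in simp)
  also have "card (box (J - {j}) (2 * b * R)) = (4 * b * R + 1) ^ (card J - 1)"
    using J by (simp add: card_box mult.assoc)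
  finally show ?thesis by simp
qed

definition quadform :: "'i set \<Rightarrow> ('i \<Rightarrow> 'i \<Rightarrow> int) \<Rightarrow> ('i \<Rightarrow> int) \<Rightarrow> int" where
  "quadform J q y = (\<Sum>k\<in>J. \<Sum>l\<in>J. q k l * y k * y l)"

lemma quadform_cong: "(\<And>i. i \<in> J \<Longrightarrow> x i = y i) \<Longrightarrow> quadform J q x = quadform J q y"
  unfolding quadform_def by (intro sum.cong) auto

lemma quadform_add_scaled:
  assumes "\<And>k l. q k l = q l k"
  shows "quadform J q (\<lambda>i. x i + m * v i) =
    quadform J q x + 2 * m * (\<Sum>k\<in>J. \<Sum>l\<in>J. q k l * x k * v l) + m^2 * quadform J q v"
proof -
  have sw: "(\<Sum>k\<in>J. \<Sum>l\<in>J. q k l * v k * x l) = (\<Sum>k\<in>J. \<Sum>l\<in>J. q k l * x k * v l)"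
    by (subst sum.swap) (intro sum.cong refl, simp add: assms mult_ac)
  have "quadform J q (\<lambda>i. x i + m * v i) =
    quadform J q x + m * (\<Sum>k\<in>J. \<Sum>l\<in>J. q k l * x k * v l)
      + m * (\<Sum>k\<in>J. \<Sum>l\<in>J. q k l * v k * x l) + m^2 * quadform J q v"
    unfolding quadform_def
    by (simp add: algebra_simps sum.distrib sum_distrib_left power2_eq_square)
  then show ?thesis unfolding sw by simp
qed

lemma sum_mult_unit:
  fixes f :: "'i \<Rightarrow> int"
  shows "finite J \<Longrightarrow> i \<in> J \<Longrightarrow> (\<Sum>k\<in>J. f k * (if k = i then 1 else 0)) = f i"
  by (subst sum.remove[of J i]) (auto intro!: sum.neutral)

lemma quadform_single:
  assumes "finite J" "i \<in> J"
  shows "quadform J q (\<lambda>k. if k = i then 1 else 0) = q i i"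
  unfolding quadform_def by (simp only: sum_mult_unit[OF assms])

lemma quadform_insert:
  assumes "finite J" "i \<notin> J" "\<And>k l. q k l = q l k"
  shows "quadform (insert i J) q y = q i i * y i ^ 2 + 2 * y i * (\<Sum>k\<in>J. q i k * y k) + quadform J q y"
proof -
  have "(\<Sum>k\<in>J. q k i * y k * y i) = y i * (\<Sum>k\<in>J. q i k * y k)"
    unfolding sum_distrib_left by (intro sum.cong refl) (simp add: assms(3) mult_ac)
  moreover have "(\<Sum>k\<in>J. q i k * y i * y k) = y i * (\<Sum>k\<in>J. q i k * y k)"
    unfolding sum_distrib_left by (intro sum.cong refl) (simp add: mult_ac)
  ultimately show ?thesis
    using assms(1,2) unfolding quadform_def
    by (simp add: sum.distrib power2_eq_square algebra_simps)
qed

text \<open>Restricting the direction to \<open>e\<^sub>i\<close> and \<open>e\<^sub>i + e\<^sub>j\<close> keeps the bound uniform in the form.\<close>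

lemma quadform_direction:
  fixes q :: "'i \<Rightarrow> 'i \<Rightarrow> int"
  assumes J: "finite J" and sym: "\<And>k l. q k l = q l k" and k: "k \<in> J" "l \<in> J" "q k l \<noteq> 0"
  obtains v :: "'i \<Rightarrow> int" and j where "j \<in> J" "v j = 1" "\<And>i. \<bar>v i\<bar> \<le> 1" "quadform J q v \<noteq> 0"
proof -
  define u :: "'i \<Rightarrow> 'i \<Rightarrow> int" where "u = (\<lambda>i k. if k = i then 1 else 0)"
  have u: "quadform J q (u i) = q i i" if "i \<in> J" for i
    unfolding u_def using quadform_single[OF J that] .
  consider "q k k \<noteq> 0" | "q l l \<noteq> 0" | "q k k = 0" "q l l = 0" by blast
  then show ?thesis
  proof cases
    case 1
    then show ?thesis using that[of k "u k"] u k by (auto simp: u_def)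
  next
    case 2
    then show ?thesis using that[of l "u l"] u k by (auto simp: u_def)
  next
    case 3
    then have kl: "k \<noteq> l" using k by auto
    have "(\<Sum>m\<in>J. \<Sum>n\<in>J. q m n * u k m * u l n) = q k l"
      unfolding u_def using J k by (simp only: sum_mult_unit)
    then have "quadform J q (\<lambda>i. u k i + 1 * u l i) = 2 * q k l"
      using quadform_add_scaled[OF sym, where J = J and x = "u k" and m = 1 and v = "u l"] u k 3 by simp
    then show ?thesis using that[of k "\<lambda>i. u k i + 1 * u l i"] k kl by (auto simp: u_def)
  qed
qed

text \<open>Along a direction where the form does not vanish, the equation is a genuine quadratic in
  the parameter, with at most two roots. The direction has entries of size at most one, so the bound
  does not involve \<open>q\<close>, \<open>L\<close> or \<open>c\<close>.\<close>

lemma card_quadric_le: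
  fixes q :: "'i \<Rightarrow> 'i \<Rightarrow> int"
  assumes J: "finite J" and sym: "\<And>k l. q k l = q l k" and k: "k \<in> J" "l \<in> J" "q k l \<noteq> 0"
  shows "card {y \<in> box J R. quadform J q y + (\<Sum>i\<in>J. L i * y i) + c = 0} \<le> 2 * (4 * R + 1) ^ (card J - 1)"
proof -
  obtain v :: "'i \<Rightarrow> int" and j where v: "j \<in> J" "v j = 1" "\<And>i. \<bar>v i\<bar> \<le> 1" "quadform J q v \<noteq> 0"
    using quadform_direction[OF J sym k] by metis
  define S where "S = {y \<in> box J R. quadform J q y + (\<Sum>i\<in>J. L i * y i) + c = 0}"
  have "card S \<le> 2 * (4 * 1 * R + 1) ^ (card J - 1)"
  proof (rule card_box_line_le[OF J v(1)])
    show "S \<subseteq> box J R" by (auto simp: S_def)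
    show "v j \<noteq> 0" using v by simp
    show "\<bar>v i\<bar> \<le> int 1" for i using v by simp
    fix x assume x: "x \<in> S"
    let ?b = "2 * (\<Sum>k\<in>J. \<Sum>l\<in>J. q k l * x k * v l) + (\<Sum>i\<in>J. L i * v i)"
    \<comment> \<open>The constant term vanishes because the base point \<open>x\<close> itself
      satisfies the equation.\<close>
    let ?p = "[:0, ?b, quadform J q v:]"
    have "poly ?p (y j - x j) = 0"
      if y: "y \<in> S" and e: "\<forall>i\<in>J. v j * (y i - x i) = (y j - x j) * v i" for y
    proof -
      define m where "m = y j - x j"
      have yi: "y i = x i + m * v i" if "i \<in> J" for i
        using e that v(2) by (auto simp: m_def algebra_simps)
      have "quadform J q y = quadform J q (\<lambda>i. x i + m * v i)"
        by (rule quadform_cong) (rule yi)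
      moreover have "(\<Sum>i\<in>J. L i * y i) = (\<Sum>i\<in>J. L i * x i) + m * (\<Sum>i\<in>J. L i * v i)"
        using yi by (simp add: algebra_simps sum.distrib sum_distrib_left cong: sum.cong)
      ultimately have "m * ?b + m^2 * quadform J q v = 0"
        using x y unfolding S_def quadform_add_scaled[OF sym, where J = J and x = x and m = m and v = v]
        by (simp add: algebra_simps)
      then show ?thesis unfolding m_def[symmetric] by (simp add: power2_eq_square algebra_simps)
    qed
    then show "\<exists>p :: int poly. p \<noteq> 0 \<and> degree p \<le> 2 \<and>
      (\<forall>y\<in>S. (\<forall>i\<in>J. v j * (y i - x i) = (y j - x j) * v i) \<longrightarrow> poly p (y j - x j) = 0)"
      using v(4) by (intro exI[of _ ?p]) auto
  qed
  then show ?thesis by (simp add: S_def)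
qed

section \<open>Quadratic forms of rank at least two\<close>

lemma abs_linear_le:
  assumes "finite I" "y \<in> box I R" "\<And>k. k \<in> I \<Longrightarrow> \<bar>q k\<bar> \<le> int (A * R)"
  shows "real_of_int \<bar>\<Sum>k\<in>I. q k * y k\<bar> \<le> real (card I * A * R^2)"
proof -
  have "\<bar>\<Sum>k\<in>I. q k * y k\<bar> \<le> (\<Sum>k\<in>I. \<bar>q k * y k\<bar>)" by (rule sum_abs)
  also have "\<dots> \<le> (\<Sum>k\<in>I. int (A * R) * int R)"
    unfolding abs_mult using assms by (intro sum_mono mult_mono) (auto intro: box_abs_le)
  also have "\<dots> = int (card I * A * R^2)" by (simp add: power2_eq_square)
  finally have "real_of_int \<bar>\<Sum>k\<in>I. q k * y k\<bar> \<le> real_of_int (int (card I * A * R^2))"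
    by (rule of_int_le_iff[THEN iffD2])
  then show ?thesis by simp
qed

text \<open>Block reduction cleared of denominators: the binary form is the adjugate of the
  \<open>{i, j}\<close> block, evaluated at half the partial derivatives \<open>Z i\<close>,
  \<open>Z j\<close>, and \<open>g\<close> is \<delta> times the Schur complement of that block. The
  second identity, without completed squares, serves the degenerate case; the last two recover
  \<open>y i\<close> and \<open>y j\<close> from \<open>Z\<close>.\<close>

lemma quadform_split:
  fixes q :: "'i \<Rightarrow> 'i \<Rightarrow> int" and y :: "'i \<Rightarrow> int"
  assumes I: "finite I" and ij: "i \<in> I" "j \<in> I" "i \<noteq> j" and sym: "\<And>k l. q k l = q l k"
  defines "J \<equiv> I - {i, j}"
  defines "\<delta> \<equiv> q i i * q j j - q i j ^ 2"
  defines "Z \<equiv> \<lambda>k. \<Sum>l\<in>I. q k l * y l"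
  defines "g \<equiv> \<lambda>k l. \<delta> * q k l - q j j * q i k * q i l + q i j * (q i k * q j l + q j k * q i l)
      - q i i * q j k * q j l"
  shows "\<delta> * quadform I q y
      = q j j * Z i ^ 2 - 2 * q i j * Z i * Z j + q i i * Z j ^ 2 + quadform J g y"
    and "quadform I q y = quadform {i, j} q y
      + (\<Sum>k\<in>{i, j}. (2 * (\<Sum>l\<in>J. q k l * y l)) * y k) + quadform J q y"
    and "Z i = q i i * y i + q i j * y j + (\<Sum>l\<in>J. q i l * y l)"
    and "Z j = q i j * y i + q j j * y j + (\<Sum>l\<in>J. q j l * y l)"
proof -
  define W where "W = (\<lambda>k. \<Sum>l\<in>J. q k l * y l)"
  have J: "finite J" "i \<notin> insert j J" "j \<notin> J" and IJ: "I = insert i (insert j J)"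
    using I ij by (auto simp: J_def)
  have Zk: "Z k = q k i * y i + q k j * y j + W k" for k
    unfolding Z_def W_def IJ using J by simp
  show Zi: "Z i = q i i * y i + q i j * y j + (\<Sum>l\<in>J. q i l * y l)"
    using Zk[of i] by (simp add: W_def)
  show Zj: "Z j = q i j * y i + q j j * y j + (\<Sum>l\<in>J. q j l * y l)"
    using Zk[of j] sym[of j i] by (simp add: W_def)
  have Q: "quadform I q y = q i i * y i ^ 2 + 2 * y i * (q i j * y j + W i)
      + q j j * y j ^ 2 + 2 * y j * W j + quadform J q y"
    unfolding IJ using J
    by (simp add: quadform_insert[OF _ _ sym] W_def)
  have Q2: "quadform {i, j} q y = q i i * y i ^ 2 + 2 * y i * q i j * y j + q j j * y j ^ 2"
    using ij(3) sym[of j i] by (simp add: quadform_def power2_eq_square algebra_simps)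
  show "quadform I q y = quadform {i, j} q y
      + (\<Sum>k\<in>{i, j}. (2 * (\<Sum>l\<in>J. q k l * y l)) * y k) + quadform J q y"
    unfolding Q Q2 using ij(3) by (simp add: W_def algebra_simps)
  have WW: "W a * W b = (\<Sum>k\<in>J. \<Sum>l\<in>J. q a k * q b l * y k * y l)" for a b
    unfolding W_def sum_product by (intro sum.cong refl) (simp add: mult_ac)
  have "quadform J g y = \<delta> * quadform J q y - q j j * (W i * W i)
      + q i j * (W i * W j + W j * W i) - q i i * (W j * W j)"
    unfolding WW quadform_def g_def
    by (simp add: algebra_simps sum.distrib sum_distrib_left sum_subtractf)
  then show "\<delta> * quadform I q y
      = q j j * Z i ^ 2 - 2 * q i j * Z i * Z j + q i i * Z j ^ 2 + quadform J g y"
    unfolding Q Zk[of i] Zk[of j] \<delta>_def using sym[of j i] by (simp add: power2_eq_square algebra_simps)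
qed

text \<open>Completing the square in \<open>y\<^sub>i, y\<^sub>j\<close> turns the equation into a representation of some \<open>N\<close>,
  depending on the other variables, by a binary form. Given these variables it has few solutions
  unless \<open>N = 0\<close>; the latter is a nontrivial quadratic condition on them, because its constant
  term is \<open>- \<delta> c \<noteq> 0\<close>.\<close>

lemma quadform_count:
  fixes I :: "'i set" and \<epsilon> :: real and A :: nat
  assumes I: "finite I" and e: "\<epsilon> > 0" and A: "A \<ge> 1"
  shows "\<exists>K\<ge>0. \<forall>(q :: 'i \<Rightarrow> 'i \<Rightarrow> int) i j c R. (\<forall>k l. q k l = q l k) \<longrightarrow> i \<in> I \<longrightarrow> j \<in> I \<longrightarrow>
    q i i * q j j - q i j ^ 2 \<noteq> 0 \<longrightarrow> c \<noteq> 0 \<longrightarrow> R \<ge> 1 \<longrightarrow>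
    (\<forall>k\<in>I. \<forall>l\<in>I. \<bar>q k l\<bar> \<le> int (A * R)) \<longrightarrow>
    real (card {y \<in> box I R. quadform I q y + c = 0}) \<le> K * real R ^ (card I - 2) * real R powr \<epsilon>"
proof -
  obtain k where k: "k \<ge> 0" and bin: "\<And>a b c N B. a * c - b^2 \<noteq> 0 \<Longrightarrow> N \<noteq> 0 \<Longrightarrow> B \<ge> 1 \<Longrightarrow>
      real_of_int \<bar>a\<bar> \<le> B \<Longrightarrow> real_of_int \<bar>b\<bar> \<le> B \<Longrightarrow> real_of_int \<bar>c\<bar> \<le> B \<Longrightarrow>
      real (card (binform_sols a b c N B)) \<le> k * B powr (\<epsilon> / 2)"
    using binform_sols_bound[of "\<epsilon> / 2"] e by auto
  define n where "n = card I - 2"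
  define k' where "k' = k * real (card I * A) powr (\<epsilon> / 2)"
  have k': "k' \<ge> 0" using k by (simp add: k'_def)
  \<comment> \<open>The 4 comes from two applications of \<open>card_quadric_le\<close> in the case
    of vanishing \<open>N\<close>; the 5 from bounding \<open>2 * R + 1\<close> and
    \<open>4 * R + 1\<close> by \<open>5 * R\<close>.\<close>
  define K where "K = (k' + 4) * 5 ^ n"
  have "real (card {y \<in> box I R. quadform I q y + c = 0}) \<le> K * real R ^ n * real R powr \<epsilon>"
    if sym: "\<And>k l. q k l = q l k" and ij: "i \<in> I" "j \<in> I" and \<delta>0: "q i i * q j j - q i j ^ 2 \<noteq> 0"
      and c: "c \<noteq> 0" and R: "R \<ge> 1" and qA: "\<And>k l. k \<in> I \<Longrightarrow> l \<in> I \<Longrightarrow> \<bar>q k l\<bar> \<le> int (A * R)"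
    for q :: "'i \<Rightarrow> 'i \<Rightarrow> int" and i j c R
  proof -
    have ne: "i \<noteq> j" using \<delta>0 by (auto simp: power2_eq_square)
    define J where "J = I - {i, j}"
    have J: "finite J" and cJ: "card J = n" using I ij ne by (simp_all add: J_def n_def)
    define \<delta> where "\<delta> = q i i * q j j - q i j ^ 2"
    define g where "g = (\<lambda>k l. \<delta> * q k l - q j j * q i k * q i l
      + q i j * (q i k * q j l + q j k * q i l) - q i i * q j k * q j l)"
    have gsym: "g k l = g l k" for k l unfolding g_def using sym[of k l] by (simp add: mult_ac)
    define Z where "Z = (\<lambda>y k. \<Sum>l\<in>I. q k l * y l)"
    define N where "N = (\<lambda>y. - (quadform J g y + \<delta> * c))"
    define S where "S = {y \<in> box I R. quadform I q y + c = 0}"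
    define f where "f = (\<lambda>y :: 'i \<Rightarrow> int. restrict y J)"
    have fbox: "f y \<in> box J R" if "y \<in> box I R" for y
      unfolding f_def using box_abs_le[OF that] by (intro restrict_in_box) (auto simp: J_def)
    have Nf: "N (f y) = N y" for y
      unfolding N_def f_def by (simp cong: quadform_cong)
    note split = quadform_split[where q = q, OF I ij ne sym, folded J_def \<delta>_def, folded g_def]
    have eqN: "q j j * Z y i ^ 2 - 2 * q i j * Z y i * Z y j + q i i * Z y j ^ 2 = N y"
      if "y \<in> S" for y
    proof -
      have "\<delta> * quadform I q y = - (\<delta> * c)" using that by (simp add: S_def eq_neg_iff_add_eq_0 flip: distrib_left)
      then show ?thesis using split(1)[where y = y] by (simp add: N_def Z_def)
    qed
    \<comment> \<open>This dominates the coefficients of the binary form as well as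
      \<open>Z y i\<close>, a sum of \<open>card I\<close> terms of size at most
      \<open>A * R * R\<close>. Its order \<open>R^2\<close> is the reason for using
      \<open>\<epsilon> / 2\<close> above.\<close>
    define B where "B = real (card I * A * R^2)"
    have cI: "card I > 0" using I ij by (auto simp: card_gt_0_iff)
    have B1: "B \<ge> 1" using cI A R by (simp add: B_def Suc_le_eq flip: of_nat_mult of_nat_power)
    have qB: "real_of_int \<bar>q k l\<bar> \<le> B" if "k \<in> I" "l \<in> I" for k l
    proof -
      have "A * R \<le> card I * A * R^2" using cI R by (simp add: power2_eq_square)
      then have "\<bar>q k l\<bar> \<le> int (card I * A * R^2)" using qA[OF that] by linarith
      then have "real_of_int \<bar>q k l\<bar> \<le> real_of_int (int (card I * A * R^2))" by (rule of_int_le_iff[THEN iffD2])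
      then show ?thesis by (simp add: B_def)
    qed
    have same_i_j: "y = y'" if "y \<in> box I R" "y' \<in> box I R" "f y = f y'" "y i = y' i" "y j = y' j" for y y'
    proof (rule box_ext[OF that(1,2)])
      fix l assume "l \<in> I"
      moreover have "f y l = f y' l" using that(3) by simp
      ultimately show "y l = y' l" using that(4,5)
        by (cases "l \<in> J") (auto simp: f_def J_def)
    qed
    define S1 where "S1 = {y \<in> S. N y \<noteq> 0}"
    define S0 where "S0 = {y \<in> S. N y = 0}"
    have fS: "finite S" unfolding S_def by (rule finite_subset[OF _ finite_box[OF I, of R]]) auto
    have f01: "finite S0" "finite S1" using fS by (auto simp: S0_def S1_def)
    have R5: "real (2 * R + 1) \<le> 5 * real R" "real (4 * R + 1) \<le> 5 * real R" using R by auto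
    have Re: "real R powr \<epsilon> \<ge> 1" using R e by (simp add: ge_one_powr_ge_zero)

    \<comment> \<open>On a fibre of \<open>f\<close> the pair \<open>(Z y i, Z y j)\<close>
      determines \<open>y i\<close> and \<open>y j\<close> by Cramer's rule, \<delta> being the
      determinant.\<close>
    have "real (card S1) \<le> k' * real R powr \<epsilon> * real (card (f ` S1))"
    proof (rule card_fibres_le[OF f01(2)])
      fix u assume u: "u \<in> f ` S1"
      then have N0: "N u \<noteq> 0" by (auto simp: S1_def Nf)
      let ?T = "binform_sols (q j j) (- q i j) (q i i) (N u) B"
      have "card {y \<in> S1. f y = u} \<le> card ?T"
      proof (rule card_inj_on_le)
        show "(\<lambda>y. (Z y i, Z y j)) ` {y \<in> S1. f y = u} \<subseteq> ?T"
        proof clarify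
          fix y assume y: "y \<in> S1" "u = f y"
          then have "y \<in> box I R" "y \<in> S" by (auto simp: S1_def S_def)
          then show "(Z y i, Z y j) \<in> binform_sols (q j j) (- q i j) (q i i) (N (f y)) B"
            using eqN[of y] ij qA
              abs_linear_le[OF I, of y R "q i" A] abs_linear_le[OF I, of y R "q j" A]
            by (simp add: binform_sols_def Nf Z_def B_def)
        qed
        show "inj_on (\<lambda>y. (Z y i, Z y j)) {y \<in> S1. f y = u}"
        proof (rule inj_onI)
          fix y y' assume y: "y \<in> {y \<in> S1. f y = u}" and y': "y' \<in> {y \<in> S1. f y = u}"
            and e: "(Z y i, Z y j) = (Z y' i, Z y' j)"
          have "y l = y' l" if "l \<in> J" for l
          proof -
            have "f y l = f y' l" using y y' by simp
            then show ?thesis using that by (simp add: f_def)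
          qed
          then have W: "(\<Sum>l\<in>J. q k l * y l) = (\<Sum>l\<in>J. q k l * y' l)" for k by simp
          have e1: "q i i * y i + q i j * y j = q i i * y' i + q i j * y' j"
            using e W[of i] unfolding Z_def split(3) by simp
          have e2: "q i j * y i + q j j * y j = q i j * y' i + q j j * y' j"
            using e W[of j] unfolding Z_def split(4) by simp
          have "\<delta> * y i = q j j * (q i i * y i + q i j * y j) - q i j * (q i j * y i + q j j * y j)"
            by (simp add: \<delta>_def power2_eq_square algebra_simps)
          also have "\<dots> = \<delta> * y' i"
            unfolding e1 e2 by (simp add: \<delta>_def power2_eq_square algebra_simps)
          finally have yi: "y i = y' i" using \<delta>0 by (simp add: \<delta>_def)
          have "\<delta> * y j = q i i * (q i j * y i + q j j * y j) - q i j * (q i i * y i + q i j * y j)"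
            by (simp add: \<delta>_def power2_eq_square algebra_simps)
          also have "\<dots> = \<delta> * y' j"
            unfolding e1 e2 by (simp add: \<delta>_def power2_eq_square algebra_simps)
          finally have yj: "y j = y' j" using \<delta>0 by (simp add: \<delta>_def)
          show "y = y'" 
            by (rule same_i_j) (use y y' yi yj in \<open>auto simp: S1_def S_def\<close>)
        qed
      qed (rule finite_binform_sols)
      then have "real (card {y \<in> S1. f y = u}) \<le> real (card ?T)" by simp
      also have "\<dots> \<le> k * B powr (\<epsilon> / 2)"
        using \<delta>0 N0 B1 qB ij by (intro bin) (auto simp: mult.commute)
      also have "B powr (\<epsilon> / 2) = real (card I * A) powr (\<epsilon> / 2) * real R powr \<epsilon>"
      proof -
        have "real R ^ 2 = real R powr 2" using R powr_realpow[of "real R" 2] by simp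
        then have "(real R ^ 2) powr (\<epsilon> / 2) = real R powr \<epsilon>" by (simp only: powr_powr) simp
        then show ?thesis by (simp add: B_def powr_mult)
      qed
      finally show "real (card {y \<in> S1. f y = u}) \<le> k' * real R powr \<epsilon>" by (simp add: k'_def)
    qed
    also have "\<dots> \<le> k' * real R powr \<epsilon> * (5 * real R) ^ n"
    proof (intro mult_left_mono)
      have "card (f ` S1) \<le> card (box J R)"
        using fbox by (intro card_mono finite_box J) (auto simp: S1_def S_def)
      then have "real (card (f ` S1)) \<le> real (2 * R + 1) ^ n"
        using J cJ by (metis card_box of_nat_le_iff of_nat_power)
      also have "\<dots> \<le> (5 * real R) ^ n" using R5 by (intro power_mono) auto
      finally show "real (card (f ` S1)) \<le> (5 * real R) ^ n" .
    qed (use k' in simp)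
    finally have c1: "real (card S1) \<le> k' * real R powr \<epsilon> * (5 * real R) ^ n" .

    \<comment> \<open>A binary form may represent zero along whole lines, so a fibre is now only
      bounded as a conic in \<open>(y i, y j)\<close>. The factor \<open>R\<close> lost here is
      regained from the condition on \<open>f y\<close>.\<close>
    have c0: "real (card S0) \<le> real (2 * (4 * R + 1)) * real (card (f ` S0))"
    proof (rule card_fibres_le[OF f01(1)])
      fix u assume u: "u \<in> f ` S0"
      define L where "L = (\<lambda>k. 2 * (\<Sum>l\<in>J. q k l * u l))"
      let ?T = "{y \<in> box {i, j} R. quadform {i, j} q y + (\<Sum>k\<in>{i, j}. L k * y k) + (quadform J q u + c) = 0}"
      have "card {y \<in> S0. f y = u} \<le> card ?T"
      proof (rule card_inj_on_le)
        show "inj_on (\<lambda>y. restrict y {i, j}) {y \<in> S0. f y = u}"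
        proof (rule inj_onI)
          fix y y' assume y: "y \<in> {y \<in> S0. f y = u}" and y': "y' \<in> {y \<in> S0. f y = u}"
            and e: "restrict y {i, j} = restrict y' {i, j}"
          show "y = y'" 
            by (rule same_i_j)
              (use y y' fun_cong[OF e, of i] fun_cong[OF e, of j] in \<open>auto simp: S0_def S_def\<close>)
        qed
        show "(\<lambda>y. restrict y {i, j}) ` {y \<in> S0. f y = u} \<subseteq> ?T"
        proof clarify
          fix y assume y: "y \<in> S0" "u = f y"
          then have yb: "y \<in> box I R" and ys: "quadform I q y + c = 0" by (auto simp: S0_def S_def)
          have uy: "u l = y l" if "l \<in> J" for l using y that by (simp add: f_def)
          have "L k = 2 * (\<Sum>l\<in>J. q k l * y l)" for k by (simp add: L_def uy)
          moreover have "quadform J q u = quadform J q y" using uy by (rule quadform_cong)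
          moreover have "quadform {i, j} q (restrict y {i, j}) = quadform {i, j} q y"
            by (rule quadform_cong) auto
          ultimately have "quadform {i, j} q (restrict y {i, j})
              + (\<Sum>k\<in>{i, j}. L k * restrict y {i, j} k) + (quadform J q u + c) = 0"
            using ys split(2)[where y = y] by simp
          moreover have "restrict y {i, j} \<in> box {i, j} R"
            using box_abs_le[OF yb] ij by (intro restrict_in_box) auto
          ultimately show "restrict y {i, j} \<in> box {i, j} R \<and> quadform {i, j} q (restrict y {i, j})
              + (\<Sum>k\<in>{i, j}. L k * restrict y {i, j} k) + (quadform J q (f y) + c) = 0"
            using y by simp
        qed
        show "finite ?T" by (rule finite_subset[OF _ finite_box[of "{i, j}" R]]) auto
      qed
      also have "card ?T \<le> 2 * (4 * R + 1) ^ (card {i, j} - 1)"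
      proof -
        have "q i i \<noteq> 0 \<or> q i j \<noteq> 0" using \<delta>0 by auto
        then obtain l where "l \<in> {i, j}" "q i l \<noteq> 0" by auto
        then show ?thesis by (intro card_quadric_le[OF _ sym, of _ i l]) auto
      qed
      finally show "real (card {y \<in> S0. f y = u}) \<le> real (2 * (4 * R + 1))"
        using ne by simp
    qed
    \<comment> \<open>Either \<open>g\<close> has a nonzero coefficient and \<open>f y\<close> lies
      on a quadric, or \<open>N\<close> is the nonzero constant \<open>- (\<delta> * c)\<close> and
      there is nothing to count.\<close>
    have "real (card S0) \<le> 4 * (5 * real R) ^ n"
    proof (cases "\<exists>k\<in>J. \<exists>l\<in>J. g k l \<noteq> 0")
      case True
      then obtain k l where kl: "k \<in> J" "l \<in> J" "g k l \<noteq> 0" by blast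
      let ?T = "{y \<in> box J R. quadform J g y + (\<Sum>i\<in>J. 0 * y i) + \<delta> * c = 0}"
      have "f ` S0 \<subseteq> ?T"
      proof clarify
        fix y assume y: "y \<in> S0"
        then have "N (f y) = 0" by (simp add: S0_def Nf)
        then show "f y \<in> box J R \<and> quadform J g (f y) + (\<Sum>i\<in>J. 0 * f y i) + \<delta> * c = 0"
          using y fbox by (simp add: N_def S0_def S_def)
      qed
      moreover have "finite ?T" by (rule finite_subset[OF _ finite_box[OF J, of R]]) auto
      ultimately have "card (f ` S0) \<le> card ?T" by (intro card_mono)
      also have "\<dots> \<le> 2 * (4 * R + 1) ^ (card J - 1)"
        by (rule card_quadric_le[OF J gsym kl])
      finally have "(2 * (4 * R + 1)) * card (f ` S0) \<le> (2 * (4 * R + 1)) * (2 * (4 * R + 1) ^ (n - 1))"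
        unfolding cJ by (rule mult_le_mono2)
      also have "\<dots> = 4 * (4 * R + 1) ^ n"
      proof -
        have "n \<noteq> 0" using kl(1) J cJ by (metis card_0_eq empty_iff)
        then show ?thesis by (cases n) (simp_all add: mult_ac)
      qed
      finally have "real ((2 * (4 * R + 1)) * card (f ` S0)) \<le> real (4 * (4 * R + 1) ^ n)"
        by (rule of_nat_mono)
      with c0 have "real (card S0) \<le> real (4 * (4 * R + 1) ^ n)"
        by (simp only: of_nat_mult)
      then have "real (card S0) \<le> 4 * real (4 * R + 1) ^ n"
        by (simp only: of_nat_mult of_nat_power of_nat_numeral)
      also have "\<dots> \<le> 4 * (5 * real R) ^ n" using R5 by (intro mult_left_mono power_mono) auto
      finally show ?thesis .
    next
      case False
      then have "quadform J g y = 0" for y unfolding quadform_def by (intro sum.neutral ballI) simp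
      then have "S0 = {}" using c \<delta>0 by (auto simp: S0_def N_def \<delta>_def)
      then show ?thesis by simp
    qed
    moreover have "S = S0 \<union> S1" "S0 \<inter> S1 = {}" by (auto simp: S0_def S1_def)
    then have "card S = card S0 + card S1" using f01 by (simp add: card_Un_disjoint)
    ultimately have "real (card S) \<le> 4 * (5 * real R) ^ n * 1 + k' * real R powr \<epsilon> * (5 * real R) ^ n"
      using c1 by simp
    also have "\<dots> \<le> 4 * (5 * real R) ^ n * real R powr \<epsilon> + k' * real R powr \<epsilon> * (5 * real R) ^ n"
      using mult_left_mono[OF Re, of "4 * (5 * real R) ^ n"] by simp
    also have "\<dots> = K * real R ^ n * real R powr \<epsilon>"
      by (simp add: K_def power_mult_distrib algebra_simps)
    finally show ?thesis by (simp add: S_def)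
  qed
  moreover have "K \<ge> 0" using k' by (simp add: K_def)
  ultimately show ?thesis unfolding n_def by blast
qed

section \<open>Symmetric trilinear forms\<close>

locale symmetric_trilinear =
  fixes s :: nat and t :: "nat \<Rightarrow> nat \<Rightarrow> nat \<Rightarrow> int"
  assumes sym12: "t i j k = t j i k" and sym23: "t i j k = t i k j"
begin

definition T :: "(nat \<Rightarrow> int) \<Rightarrow> (nat \<Rightarrow> int) \<Rightarrow> (nat \<Rightarrow> int) \<Rightarrow> int" where
  "T x y z = (\<Sum>i<s. \<Sum>j<s. \<Sum>k<s. t i j k * x i * y j * z k)"

text \<open>Entry \<open>(i, j)\<close> of the Hessian matrix at \<open>h\<close> of the cubic form
  \<open>T x x x / 6\<close>.\<close>

definition L :: "nat \<Rightarrow> nat \<Rightarrow> (nat \<Rightarrow> int) \<Rightarrow> int" where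
  "L i j h = (\<Sum>k<s. t i j k * h k)"

definition unit :: "nat \<Rightarrow> nat \<Rightarrow> int" where
  "unit i = (\<lambda>k. if k = i then 1 else 0)"

lemma T_swap12: "T x y z = T y x z"
  unfolding T_def by (subst sum.swap) (intro sum.cong refl, simp add: sym12 mult_ac)

lemma T_swap23: "T x y z = T x z y"
  unfolding T_def by (rule sum.cong[OF refl], subst sum.swap, intro sum.cong refl)
    (simp add: sym23 mult_ac)

lemma T_add1: "T (\<lambda>i. x i + y i) u v = T x u v + T y u v"
  unfolding T_def by (simp add: sum.distrib distrib_left distrib_right)

lemma T_scale1: "T (\<lambda>i. c * x i) u v = c * T x u v"
  unfolding T_def by (simp add: sum_distrib_left mult_ac)

lemma T_add2: "T u (\<lambda>i. x i + y i) v = T u x v + T u y v"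
  using T_add1 T_swap12 by metis

lemma T_add3: "T u v (\<lambda>i. x i + y i) = T u v x + T u v y"
  using T_add2 T_swap23 by metis

lemma T_scale2: "T u (\<lambda>i. c * x i) v = c * T u x v"
  using T_scale1 T_swap12 by metis

lemma T_scale3: "T u v (\<lambda>i. c * x i) = c * T u v x"
  using T_scale2 T_swap23 by metis

lemma T_cong:
  assumes "\<And>i. i < s \<Longrightarrow> x i = x' i" "\<And>i. i < s \<Longrightarrow> y i = y' i" "\<And>i. i < s \<Longrightarrow> z i = z' i"
  shows "T x y z = T x' y' z'"
  unfolding T_def using assms by simp

lemma T_cube_add:
  "T (\<lambda>i. x i + m * v i) (\<lambda>i. x i + m * v i) (\<lambda>i. x i + m * v i)
    = T x x x + 3 * m * T x x v + 3 * m^2 * T x v v + m^3 * T v v v"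
  using T_swap12[of v x x] T_swap23[of x v x] T_swap12[of v x v] T_swap23[of v v x]
  by (simp add: T_add1 T_add2 T_add3 T_scale1 T_scale2 T_scale3 power2_eq_square
      power3_eq_cube algebra_simps)

lemma L_add: "L i j (\<lambda>k. x k + y k) = L i j x + L i j y"
  by (simp add: L_def sum.distrib distrib_left)

lemma L_scale: "L i j (\<lambda>k. c * x k) = c * L i j x"
  by (simp add: L_def sum_distrib_left mult_ac)

lemma L_cong: "(\<And>k. k < s \<Longrightarrow> x k = y k) \<Longrightarrow> L i j x = L i j y"
  by (simp add: L_def)

lemma L_unit: "k < s \<Longrightarrow> L i j (unit k) = t i j k"
  unfolding L_def unit_def by (rule sum_mult_unit) auto

lemma L_sym: "L i j h = L j i h"
  by (simp add: L_def sym12)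

lemma T_eq_quadform: "T h y y = quadform {..<s} (\<lambda>i j. L i j h) y"
proof -
  have "T h y y = T y y h" using T_swap12 T_swap23 by metis
  then show ?thesis unfolding T_def quadform_def L_def
    by (simp add: sum_distrib_left sum_distrib_right mult_ac)
qed

lemma T_unit: "i < s \<Longrightarrow> j < s \<Longrightarrow> k < s \<Longrightarrow> T (unit i) (unit j) (unit k) = t i j k"
proof -
  assume i: "i < s" and j: "j < s" and k: "k < s"
  have f: "finite {..<s}" "i \<in> {..<s}" "j \<in> {..<s}" "k \<in> {..<s}" using i j k by auto
  have "T (unit i) (unit j) (unit k) = (\<Sum>a<s. \<Sum>b<s. t a b k * unit i a * unit j b)"
    unfolding T_def unit_def using f by (simp only: sum_mult_unit)
  also have "\<dots> = (\<Sum>a<s. t a j k * unit i a)"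
    unfolding unit_def using f by (simp only: sum_mult_unit)
  also have "\<dots> = t i j k"
    unfolding unit_def using f by (simp only: sum_mult_unit)
  finally show ?thesis .
qed

text \<open>With \<open>x = y + h\<close> and \<open>w = 2 * y + h\<close>, expansion shows that the
  left side of the new equation is \<open>4 * (T x x x - T y y y)\<close>. Working with the sum
  instead of the midpoint keeps everything integral.\<close>

lemma cube_eq_iff:
  assumes "\<And>i. i < s \<Longrightarrow> h i = x i - y i" "\<And>i. i < s \<Longrightarrow> w i = x i + y i"
  shows "T x x x = T y y y \<longleftrightarrow> 3 * T h w w + T h h h = 0"
proof -
  let ?h = "\<lambda>i. x i - y i"
  let ?w = "\<lambda>i. 2 * y i + ?h i"
  have "T x x x = T (\<lambda>i. y i + 1 * ?h i) (\<lambda>i. y i + 1 * ?h i) (\<lambda>i. y i + 1 * ?h i)"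
    by (rule T_cong) auto
  also have "\<dots> = T y y y + 3 * 1 * T y y ?h + 3 * 1^2 * T y ?h ?h + 1^3 * T ?h ?h ?h"
    by (rule T_cube_add)
  finally have x: "T x x x = T y y y + 3 * T y y ?h + 3 * T y ?h ?h + T ?h ?h ?h" by simp
  have "T ?h ?w ?w = 4 * T ?h y y + 2 * T ?h y ?h + 2 * T ?h ?h y + T ?h ?h ?h"
    unfolding T_add2 T_add3 T_scale2 T_scale3 by simp
  moreover have "T ?h y y = T y y ?h" "T ?h y ?h = T y ?h ?h" "T ?h ?h y = T y ?h ?h"
    using T_swap12 T_swap23 by metis+
  ultimately have "3 * T ?h ?w ?w + T ?h ?h ?h = 4 * (T x x x - T y y y)" using x by simp
  moreover have "T h w w = T ?h ?w ?w" "T h h h = T ?h ?h ?h"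
    using assms by (auto intro!: T_cong)
  ultimately show ?thesis by auto
qed

text \<open>Polarization: a symmetric trilinear form is determined by its values on the
  diagonal.\<close>

lemma ex_nonzero_cube:
  assumes "i < s" "j < s" "k < s" "t i j k \<noteq> 0"
  shows "\<exists>v. T v v v \<noteq> 0"
proof (rule ccontr)
  assume "\<not> ?thesis"
  then have z: "T v v v = 0" for v by auto
  \<comment> \<open>Expanding the cubes of \<open>x + y\<close> and \<open>x + 2 * y\<close> gives
    two independent linear relations between \<open>T x x y\<close> and
    \<open>T x y y\<close>.\<close>
  have two: "T x x y + T x y y = 0" for x y
    using z T_cube_add[of x 1 y] by simp
  have p: "T x x y = 0" for x y
    using two[of x y] z T_cube_add[of x 2 y] by simp
  have "T x y z = 0" for x y z
  proof -
    have "T (\<lambda>i. x i + y i) (\<lambda>i. x i + y i) z = T x x z + T x y z + T y x z + T y y z"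
      unfolding T_add1 T_add2 by simp
    then show ?thesis using p T_swap12[of y x z] by simp
  qed
  then show False using T_unit assms by metis
qed

text \<open>If the minors vanish identically, then every \<open>L i j\<close> vanishes on the kernel of a nonzero
  \<open>L z z\<close>, so all of them are proportional to it, and symmetry forces \<open>t\<close> to have rank one.\<close>

lemma cube_of_minors_zero:
  assumes van: "\<And>i j h. i < s \<Longrightarrow> j < s \<Longrightarrow> L i i h * L j j h = L i j h ^ 2"
  shows "\<exists>(a::rat) b. \<forall>i<s. \<forall>j<s. \<forall>k<s. of_int (t i j k) = a * b i * b j * b k"
proof (cases "\<forall>i<s. \<forall>k<s. t i i k = 0")
  case True
  have "t i j k = 0" if "i < s" "j < s" "k < s" for i j k
  proof -
    have "L i i (unit k) = 0" using True that by (simp add: L_unit)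
    then show ?thesis using van[of i j "unit k"] that by (simp add: L_unit)
  qed
  then show ?thesis by (intro exI[of _ 0]) auto
next
  case False
  then obtain z k0 where z: "z < s" "k0 < s" "t z z k0 \<noteq> 0" by auto
  have comb: "L i j (\<lambda>l. c * unit m l + d * unit n l) = c * t i j m + d * t i j n"
    if "m < s" "n < s" for i j c d m n
    using that by (simp add: L_add L_scale L_unit)
  have cross: "t z z k * t z i m = t z z m * t z i k" if imk: "i < s" "m < s" "k < s" for i m k
  proof -
    \<comment> \<open>Chosen in the kernel of \<open>L z z\<close>; the vanishing minor then forces
      \<open>L z i\<close> to vanish there too.\<close>
    let ?h = "\<lambda>l. t z z k * unit m l + (- t z z m) * unit k l"
    have h: "L a b ?h = t z z k * t a b m + (- t z z m) * t a b k" for a b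
      using imk by (intro comb)
    then have "L z z ?h = 0" by simp
    then have "L z i ?h = 0" using van[of z i ?h] z imk by simp
    then show ?thesis unfolding h by simp
  qed
  \<comment> \<open>For a form \<open>t i j k = a * b i * b j * b k\<close> these would be
    \<open>a * (b z)^3\<close> and \<open>a * (b z)^2 * b i\<close>, which explains the target
    \<open>c^2 * t i j m = \<beta> i * \<beta> j * \<beta> m\<close>.\<close>
  define c where "c = t z z z"
  define \<beta> where "\<beta> = (\<lambda>i. t z z i)"
  have c0: "c \<noteq> 0"
  proof
    assume "c = 0"
    then have "t z z k0 * t z k0 z = 0" using cross[of k0 z k0] z by (simp add: c_def)
    moreover have "t z k0 z = t z z k0" using sym23 by metis
    ultimately show False using z by simp
  qed
  have tz: "c * t z i m = \<beta> i * \<beta> m" if "i < s" "m < s" for i m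
  proof -
    have "t z i z = t z z i" using sym23 by metis
    then show ?thesis using cross[of i m z] z that by (simp add: c_def \<beta>_def)
  qed
  have ker: "L i j h = 0" if h: "L z z h = 0" and ij: "i < s" "j < s" for h i j
  proof -
    have Lz: "L z l h = 0" if "l < s" for l using van[of z l h] z that h by simp
    \<comment> \<open>On the kernel itself the minors give no direct hold on \<open>L i j\<close>.
      Moving off it by the unit vector at \<open>z\<close>, with either sign \<sigma>, makes
      \<open>L z z\<close> equal to \<open>\<sigma> * c\<close>; adding the two relations cancels
      the mixed terms and leaves \<open>2 * (c * L i j h)^2 = 0\<close>.\<close>
    have sq: "(c * L i j h + \<sigma> * (\<beta> i * \<beta> j))^2 = (\<beta> i * \<beta> j)^2" if \<sigma>: "\<sigma> * \<sigma> = 1" for \<sigma> :: int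
    proof -
      let ?g = "\<lambda>k. h k + \<sigma> * unit z k"
      have g: "L a b ?g = L a b h + \<sigma> * t a b z" for a b using z by (simp add: L_add L_scale L_unit)
      have zz: "L z z ?g = \<sigma> * c" using h by (simp add: g c_def)
      have dd: "\<sigma> * c * L l l ?g = \<beta> l ^ 2" if l: "l < s" for l
      proof -
        have "L z l ?g = \<sigma> * \<beta> l"
          using Lz[OF l] sym23[of z l z] by (simp add: g \<beta>_def)
        then have "L z z ?g * L l l ?g = (\<sigma> * \<beta> l)^2" using van[of z l ?g] z l by simp
        also have "\<dots> = \<beta> l ^ 2" using \<sigma> by (simp add: power2_eq_square)
        finally show ?thesis unfolding zz .
      qed
      have "(c * L i j ?g)^2 = (\<sigma> * \<sigma>) * c^2 * (L i i ?g * L j j ?g)"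
        using van[OF ij, of ?g] \<sigma> by (simp add: power_mult_distrib)
      also have "\<dots> = (\<sigma> * c * L i i ?g) * (\<sigma> * c * L j j ?g)"
        by (simp add: power2_eq_square algebra_simps)
      also have "\<dots> = (\<beta> i * \<beta> j)^2" unfolding dd[OF ij(1)] dd[OF ij(2)] by (simp add: power_mult_distrib)
      also have "c * L i j ?g = c * L i j h + \<sigma> * (c * t z i j)"
        using sym12[of i j z] sym23[of j i z] sym12[of j z i] sym23[of z j i]
        unfolding g by (simp add: algebra_simps)
      finally show ?thesis unfolding tz[OF ij] .
    qed
    have "2 * (c * L i j h)^2 = (c * L i j h + 1 * (\<beta> i * \<beta> j))^2
        + (c * L i j h + (-1) * (\<beta> i * \<beta> j))^2 - 2 * (\<beta> i * \<beta> j)^2"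
      by (simp add: power2_eq_square algebra_simps)
    also have "\<dots> = 0" using sq[of 1] sq[of "-1"] by simp
    finally show ?thesis using c0 by simp
  qed
  have "c^2 * t i j m = \<beta> i * \<beta> j * \<beta> m" if ij: "i < s" "j < s" "m < s" for i j m
  proof -
    \<comment> \<open>The projection of a multiple of the unit vector at \<open>m\<close> into the
      kernel of \<open>L z z\<close>.\<close>
    let ?h = "\<lambda>l. c * unit m l + (- \<beta> m) * unit z l"
    have h: "L a b ?h = c * t a b m + (- \<beta> m) * t a b z" for a b
      using ij z by (intro comb)
    then have "L z z ?h = 0" by (simp add: c_def \<beta>_def)
    then have "L i j ?h = 0" using ker ij by blast
    then have "c * t i j m = \<beta> m * t i j z" unfolding h by simp
    moreover have "t i j z = t z i j" using sym12 sym23 by metis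
    ultimately have "c * (c * t i j m) = \<beta> m * (c * t z i j)" by simp
    then show ?thesis unfolding tz[OF ij(1,2)] by (simp add: power2_eq_square mult_ac)
  qed
  then have "of_int (c^2 * t i j m) = (of_int (\<beta> i * \<beta> j * \<beta> m) :: rat)"
    if "i < s" "j < s" "m < s" for i j m
    using that by simp
  then have "of_int (t i j m) = (1 / of_int c ^ 2 :: rat) * of_int (\<beta> i) * of_int (\<beta> j) * of_int (\<beta> m)"
    if "i < s" "j < s" "m < s" for i j m
    using that c0 by (simp add: field_simps)
  then show ?thesis
    by (intro exI[of _ "1 / of_int c ^ 2"] exI[of _ "\<lambda>i. of_int (\<beta> i)"]) auto
qed

section \<open>Exceptional difference vectors\<close>

context
  fixes i j :: nat and h0 :: "nat \<Rightarrow> int"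
  assumes ij: "i < s" "j < s" and h0: "L i i h0 * L j j h0 \<noteq> L i j h0 ^ 2"
begin

lemma ij_distinct: "i \<noteq> j"
  using h0 by (auto simp: power2_eq_square)

lemma s_ge_2: "s \<ge> 2"
  using ij ij_distinct by linarith

text \<open>A minor that is nonzero at \<open>h0\<close> has a nonzero coefficient, indexed by some
  \<open>m\<close> and \<open>n\<close>. The equations \<open>L i m h = 0\<close> and
  \<open>L j n h = 0\<close> then have a nonzero determinant in \<open>h i\<close> and
  \<open>h j\<close>, so the other coordinates determine these two.\<close>

lemma card_radical_le:
  "card {h \<in> box {..<s} R. \<forall>k<s. \<forall>l<s. L k l h = 0} \<le> (2 * R + 1) ^ (s - 2)"
proof -
  have "\<exists>m<s. \<exists>n<s. t i i m * t j j n \<noteq> t i j m * t i j n"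
  proof (rule ccontr)
    assume "\<not> ?thesis"
    then have "(\<Sum>m<s. \<Sum>n<s. t i i m * t j j n * h0 m * h0 n) = (\<Sum>m<s. \<Sum>n<s. t i j m * t i j n * h0 m * h0 n)"
      by (intro sum.cong refl) auto
    then have "L i i h0 * L j j h0 = L i j h0 * L i j h0"
      unfolding L_def sum_product by (simp add: mult_ac)
    then show False using h0 by (simp add: power2_eq_square)
  qed
  then obtain m n where mn: "m < s" "n < s" "t i i m * t j j n \<noteq> t i j m * t i j n" by blast
  let ?V = "{h \<in> box {..<s} R. \<forall>k<s. \<forall>l<s. L k l h = 0}"
  let ?J = "{..<s} - {i, j}"
  have I: "{..<s} = insert i (insert j ?J)" "i \<notin> insert j ?J" "j \<notin> ?J" using ij ij_distinct by auto
  have "card ?V \<le> card (box ?J R)"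
  proof (rule card_inj_on_le)
    show "(\<lambda>h. restrict h ?J) ` ?V \<subseteq> box ?J R"
    proof clarify
      fix h assume "h \<in> box {..<s} R"
      then show "restrict h ?J \<in> box ?J R" by (intro restrict_in_box) (simp add: box_abs_le)
    qed
    show "inj_on (\<lambda>h. restrict h ?J) ?V"
    proof (rule inj_onI)
      fix x y assume x: "x \<in> ?V" and y: "y \<in> ?V" and e: "restrict x ?J = restrict y ?J"
      have eq: "x l = y l" if "l \<in> ?J" for l
      proof -
        have "restrict x ?J l = restrict y ?J l" using e by simp
        then show ?thesis using that by simp
      qed
      have Lsplit: "L k l v = t k l i * v i + t k l j * v j + (\<Sum>p\<in>?J. t k l p * v p)" for k l v
      proof -
        have "L k l v = (\<Sum>p\<in>insert i (insert j ?J). t k l p * v p)"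
          unfolding L_def using I(1) by presburger
        then show ?thesis using I(2,3) by simp
      qed
      have lin: "t k l i * (x i - y i) + t k l j * (x j - y j) = 0" if "k < s" "l < s" for k l
      proof -
        have "L k l x = 0" "L k l y = 0" using x y that by auto
        moreover have "(\<Sum>p\<in>?J. t k l p * x p) = (\<Sum>p\<in>?J. t k l p * y p)"
          using eq by (intro sum.cong) auto
        ultimately show ?thesis unfolding Lsplit by (simp add: algebra_simps)
      qed
      have a: "t i i m * (x i - y i) + t i j m * (x j - y j) = 0"
        using lin[of i m] ij mn sym23[of i m i] sym23[of i m j] by simp
      have b: "t i j n * (x i - y i) + t j j n * (x j - y j) = 0"
        using lin[of j n] ij mn sym23[of j n i] sym23[of j n j] sym12[of j i n] by simp
      define \<delta> where "\<delta> = t i i m * t j j n - t i j m * t i j n"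
      have "\<delta> * (x i - y i) = t j j n * (t i i m * (x i - y i) + t i j m * (x j - y j))
          - t i j m * (t i j n * (x i - y i) + t j j n * (x j - y j))"
        by (simp add: \<delta>_def algebra_simps)
      then have xi: "x i = y i" unfolding a b using mn by (simp add: \<delta>_def)
      have "\<delta> * (x j - y j) = t i i m * (t i j n * (x i - y i) + t j j n * (x j - y j))
          - t i j n * (t i i m * (x i - y i) + t i j m * (x j - y j))"
        by (simp add: \<delta>_def algebra_simps)
      then have xj: "x j = y j" unfolding a b using mn by (simp add: \<delta>_def)
      show "x = y"
      proof (rule box_ext)
        fix l assume "l \<in> {..<s}"
        then show "x l = y l" using eq[of l] xi xj by (cases "l \<in> ?J") auto
      qed (use x y in auto)
    qed
  qed (simp add: finite_box)
  also have "\<dots> = (2 * R + 1) ^ (s - 2)"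
    using ij ij_distinct by (simp add: card_box numeral_2_eq_2)
  finally show ?thesis .
qed

text \<open>Along lines in direction \<open>h0\<close> the minor is a quadratic polynomial whose
  leading coefficient is, up to sign, its value at \<open>h0\<close>. The constant \<open>b\<close>
  is the size of \<open>h0\<close> and hence independent of \<open>R\<close>.\<close>

lemma card_minor_zero_le:
  "\<exists>b. \<forall>R. card {h \<in> box {..<s} R. L i i h * L j j h = L i j h ^ 2} \<le> 2 * (4 * b * R + 1) ^ (s - 1)"
proof -
  have "\<exists>k<s. h0 k \<noteq> 0"
  proof (rule ccontr)
    assume "\<not> ?thesis"
    then have "L a b h0 = 0" for a b by (simp add: L_def)
    then show False using h0 by simp
  qed
  then obtain k where k: "k < s" "h0 k \<noteq> 0" by blast
  define b where "b = nat (\<Sum>l<s. \<bar>h0 l\<bar>)"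
  have b: "\<bar>h0 l\<bar> \<le> int b" if "l < s" for l
    unfolding b_def using that member_le_sum[of l "{..<s}" "\<lambda>l. \<bar>h0 l\<bar>"] by simp
  have "card {h \<in> box {..<s} R. L i i h * L j j h = L i j h ^ 2} \<le> 2 * (4 * b * R + 1) ^ (card {..<s} - 1)" for R
  proof (rule card_box_line_le[of _ k _ _ h0])
    fix x assume "x \<in> {h \<in> box {..<s} R. L i i h * L j j h = L i j h ^ 2}"
    then have x: "L i i x * L j j x = L i j x ^ 2" by simp
    \<comment> \<open>Scaling by \<open>h0 k\<close> avoids the fraction in
      \<open>y = x + (m / h0 k) * h0\<close>. The constant term of \<open>?p\<close> is zero since
      the minor vanishes at \<open>x\<close>.\<close>
    let ?c = "h0 k"
    let ?q = "2 * ?c * L i j x * L i j h0 - ?c * L i i x * L j j h0 - ?c * L i i h0 * L j j x"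
    let ?p = "[:0, ?q, L i j h0 ^ 2 - L i i h0 * L j j h0:]"
    have "poly ?p (y k - x k) = 0"
      if y: "L i i y * L j j y = L i j y ^ 2"
        and e: "\<forall>l\<in>{..<s}. h0 k * (y l - x l) = (y k - x k) * h0 l" for y
    proof -
      define m where "m = y k - x k"
      have Ly: "?c * L a b y = ?c * L a b x + m * L a b h0" for a b
      proof -
        have "L a b (\<lambda>l. ?c * y l) = L a b (\<lambda>l. ?c * x l + m * h0 l)"
        proof (rule L_cong)
          fix l assume "l < s"
          then have "h0 k * (y l - x l) = m * h0 l" using e by (simp add: m_def)
          then show "?c * y l = ?c * x l + m * h0 l" by (simp add: algebra_simps)
        qed
        then show ?thesis by (simp add: L_add L_scale)
      qed
      have "(?c * L i j y)^2 - (?c * L i i y) * (?c * L j j y) = ?c^2 * (L i j y ^ 2 - L i i y * L j j y)"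
        by (simp add: power2_eq_square algebra_simps)
      then have "(?c * L i j x + m * L i j h0)^2
          - (?c * L i i x + m * L i i h0) * (?c * L j j x + m * L j j h0) = 0"
        unfolding Ly using y by simp
      moreover have "(?c * L i j x + m * L i j h0)^2
          - (?c * L i i x + m * L i i h0) * (?c * L j j x + m * L j j h0)
          = ?c^2 * (L i j x ^ 2 - L i i x * L j j x) + poly ?p m"
        by (simp add: power2_eq_square algebra_simps)
      ultimately show ?thesis using x by (simp add: m_def)
    qed
    then show "\<exists>p :: int poly. p \<noteq> 0 \<and> degree p \<le> 2 \<and>
      (\<forall>y\<in>{h \<in> box {..<s} R. L i i h * L j j h = L i j h ^ 2}.
        (\<forall>l\<in>{..<s}. h0 k * (y l - x l) = (y k - x k) * h0 l) \<longrightarrow> poly p (y k - x k) = 0)"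
      using h0 by (intro exI[of _ ?p]) auto
  qed (use k b in auto)
  then show ?thesis by auto
qed

text \<open>The same argument for a cubic, in a direction \<open>v\<close> with
  \<open>T v v v \<noteq> 0\<close> provided by polarization.\<close>

lemma card_cubic_zero_le:
  "\<exists>b. \<forall>R. card {h \<in> box {..<s} R. T h h h = 0} \<le> 3 * (4 * b * R + 1) ^ (s - 1)"
proof -
  have "\<exists>a<s. \<exists>b<s. \<exists>c<s. t a b c \<noteq> 0"
  proof (rule ccontr)
    assume "\<not> ?thesis"
    then have "L i i h0 = 0" "L i j h0 = 0" using ij by (simp_all add: L_def)
    then show False using h0 by simp
  qed
  then obtain v where v: "T v v v \<noteq> 0" using ex_nonzero_cube by blast
  have "\<exists>k<s. v k \<noteq> 0"
  proof (rule ccontr)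
    assume "\<not> ?thesis"
    then have "T v v v = 0" by (simp add: T_def)
    then show False using v by simp
  qed
  then obtain k where k: "k < s" "v k \<noteq> 0" by blast
  define b where "b = nat (\<Sum>l<s. \<bar>v l\<bar>)"
  have b: "\<bar>v l\<bar> \<le> int b" if "l < s" for l
    unfolding b_def using that member_le_sum[of l "{..<s}" "\<lambda>l. \<bar>v l\<bar>"] by simp
  have "card {h \<in> box {..<s} R. T h h h = 0} \<le> 3 * (4 * b * R + 1) ^ (card {..<s} - 1)" for R
  proof (rule card_box_line_le[of _ k _ _ v])
    fix x assume "x \<in> {h \<in> box {..<s} R. T h h h = 0}"
    then have x: "T x x x = 0" by simp
    let ?w = "\<lambda>l. v k * x l"
    let ?p = "[:0, 3 * T ?w ?w v, 3 * T ?w v v, T v v v:]"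
    have "poly ?p (y k - x k) = 0"
      if y: "T y y y = 0" and e: "\<forall>l\<in>{..<s}. v k * (y l - x l) = (y k - x k) * v l" for y
    proof -
      define m where "m = y k - x k"
      let ?y = "\<lambda>l. v k * y l" and ?z = "\<lambda>l. v k * x l + m * v l"
      have yl: "?y l = ?z l" if "l < s" for l
      proof -
        have "v k * (y l - x l) = m * v l" using e that by (simp add: m_def)
        then show ?thesis by (simp add: algebra_simps)
      qed
      have "T ?z ?z ?z = T ?y ?y ?y"
        by (rule T_cong) (rule yl[symmetric], assumption)+
      also have "\<dots> = 0" by (simp add: T_scale1 T_scale2 T_scale3 y)
      finally have "T ?z ?z ?z = 0" .
      then have "T ?w ?w ?w + 3 * m * T ?w ?w v + 3 * m^2 * T ?w v v + m^3 * T v v v = 0"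
        unfolding T_cube_add[of ?w m v] .
      moreover have "T ?w ?w ?w = 0" using x by (simp add: T_scale1 T_scale2 T_scale3)
      ultimately show ?thesis
        unfolding m_def[symmetric] by (simp add: power2_eq_square power3_eq_cube algebra_simps)
    qed
    then show "\<exists>p :: int poly. p \<noteq> 0 \<and> degree p \<le> 3 \<and>
      (\<forall>y\<in>{h \<in> box {..<s} R. T h h h = 0}.
        (\<forall>l\<in>{..<s}. v k * (y l - x l) = (y k - x k) * v l) \<longrightarrow> poly p (y k - x k) = 0)"
      using v by (intro exI[of _ ?p]) auto
  qed (use k b in auto)
  then show ?thesis by auto
qed

lemma abs_L_le: "\<exists>A. A \<ge> 1 \<and> (\<forall>R h. h \<in> box {..<s} R \<longrightarrow> (\<forall>k<s. \<forall>l<s. \<bar>3 * L k l h\<bar> \<le> int (A * R)))"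
proof -
  define A where "A = nat (3 * (\<Sum>k<s. \<Sum>l<s. \<Sum>m<s. \<bar>t k l m\<bar>)) + 1"
  have "\<bar>3 * L k l h\<bar> \<le> int (A * R)" if h: "h \<in> box {..<s} R" and kl: "k < s" "l < s" for R h k l
  proof -
    have "\<bar>L k l h\<bar> \<le> (\<Sum>m<s. \<bar>t k l m * h m\<bar>)" unfolding L_def by (rule sum_abs)
    also have "\<dots> \<le> (\<Sum>m<s. \<bar>t k l m\<bar> * int R)"
      unfolding abs_mult using box_abs_le[OF h] by (intro sum_mono mult_left_mono) auto
    also have "\<dots> = (\<Sum>m<s. \<bar>t k l m\<bar>) * int R" by (simp add: sum_distrib_right)
    also have "\<dots> \<le> (\<Sum>k<s. \<Sum>l<s. \<Sum>m<s. \<bar>t k l m\<bar>) * int R"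
    proof (rule mult_right_mono)
      have "(\<Sum>m<s. \<bar>t k l m\<bar>) \<le> (\<Sum>l<s. \<Sum>m<s. \<bar>t k l m\<bar>)"
        using kl by (intro member_le_sum[of l _ "\<lambda>l. \<Sum>m<s. \<bar>t k l m\<bar>"]) (auto intro: sum_nonneg)
      also have "\<dots> \<le> (\<Sum>k<s. \<Sum>l<s. \<Sum>m<s. \<bar>t k l m\<bar>)"
        using kl by (intro member_le_sum[of k _ "\<lambda>k. \<Sum>l<s. \<Sum>m<s. \<bar>t k l m\<bar>"]) (auto intro!: sum_nonneg)
      finally show "(\<Sum>m<s. \<bar>t k l m\<bar>) \<le> (\<Sum>k<s. \<Sum>l<s. \<Sum>m<s. \<bar>t k l m\<bar>)" .
    qed simp
    finally have "3 * \<bar>L k l h\<bar> \<le> 3 * (\<Sum>k<s. \<Sum>l<s. \<Sum>m<s. \<bar>t k l m\<bar>) * int R" by simp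
    also have "\<dots> \<le> int A * int R" unfolding A_def by (intro mult_right_mono) auto
    finally show ?thesis by simp
  qed
  moreover have "A \<ge> 1" by (simp add: A_def)
  ultimately show ?thesis by blast
qed

section \<open>Summation over all difference vectors\<close>

lemma difference_equation_count:
  fixes \<epsilon> :: real
  assumes e: "\<epsilon> > 0"
  shows "\<exists>K\<ge>0. \<forall>R\<ge>1. real (card {(h, y) \<in> box {..<s} R \<times> box {..<s} R. 3 * T h y y + T h h h = 0})
    \<le> K * real R ^ (2 * s - 2) * real R powr \<epsilon>"
proof -
  obtain A where A: "A \<ge> 1" "\<And>R h k l. h \<in> box {..<s} R \<Longrightarrow> k < s \<Longrightarrow> l < s \<Longrightarrow> \<bar>3 * L k l h\<bar> \<le> int (A * R)"
    using abs_L_le by blast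
  obtain k where k: "k \<ge> 0" and gen: "\<And>q i j c R. (\<And>k l. q k l = q l k) \<Longrightarrow> i < s \<Longrightarrow> j < s \<Longrightarrow>
    q i i * q j j - q i j ^ 2 \<noteq> 0 \<Longrightarrow> c \<noteq> 0 \<Longrightarrow> R \<ge> 1 \<Longrightarrow>
    (\<And>k l. k < s \<Longrightarrow> l < s \<Longrightarrow> \<bar>q k l\<bar> \<le> int (A * R)) \<Longrightarrow>
    real (card {y \<in> box {..<s} R. quadform {..<s} q y + c = 0}) \<le> k * real R ^ (s - 2) * real R powr \<epsilon>"
    using quadform_count[OF finite_lessThan e A(1), of s] by auto
  obtain b1 where b1: "\<And>R. card {h \<in> box {..<s} R. L i i h * L j j h = L i j h ^ 2} \<le> 2 * (4 * b1 * R + 1) ^ (s - 1)"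
    using card_minor_zero_le by blast
  obtain b2 where b2: "\<And>R. card {h \<in> box {..<s} R. T h h h = 0} \<le> 3 * (4 * b2 * R + 1) ^ (s - 1)"
    using card_cubic_zero_le by blast
  \<comment> \<open>Large enough for \<open>X = b * R\<close> to dominate \<open>2 * R + 1\<close>,
    \<open>4 * R + 1\<close> and both \<open>4 * b1 * R + 1\<close> and
    \<open>4 * b2 * R + 1\<close>. In \<open>K\<close> the 11 is 1 for the radical plus
    \<open>5 * 2\<close> for the hypersurfaces.\<close>
  define b where "b = 4 * b1 + 4 * b2 + 5"
  define K where "K = real b ^ (2 * s) * (11 + k)"
  have "real (card {(h, y) \<in> box {..<s} R \<times> box {..<s} R. 3 * T h y y + T h h h = 0})
    \<le> K * real R ^ (2 * s - 2) * real R powr \<epsilon>" if R: "R \<ge> 1" for R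
  proof -
    let ?B = "box {..<s} R"
    define Y where "Y = (\<lambda>h. {y \<in> ?B. 3 * T h y y + T h h h = 0})"
    define V where "V = {h \<in> ?B. \<forall>k<s. \<forall>l<s. L k l h = 0}"
    define E where "E = {h \<in> ?B. L i i h * L j j h = L i j h ^ 2} \<union> {h \<in> ?B. T h h h = 0}"
    define X where "X = real b * real R"
    have fB: "finite ?B" by (simp add: finite_box)
    have b1': "real b \<ge> 1" by (simp add: b_def)
    have X1: "X \<ge> 1" using R by (simp add: X_def b_def mult_ge1_I)
    have le: "real (c * R + 1) \<le> X" if "c + 1 \<le> b" for c
    proof -
      have "c * R + 1 \<le> (c + 1) * R" using R by simp
      also have "\<dots> \<le> b * R" using that by (rule mult_le_mono1)
      finally have "real (c * R + 1) \<le> real (b * R)" by (rule of_nat_mono)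
      then show ?thesis by (simp add: X_def)
    qed
    have cB: "real (card ?B) \<le> X ^ s"
    proof -
      have "real (card ?B) = real (2 * R + 1) ^ s" by (simp add: card_box)
      also have "\<dots> \<le> X ^ s" using le[of 2] by (intro power_mono) (auto simp: b_def)
      finally show ?thesis .
    qed
    have cV: "real (card V) \<le> X ^ (s - 2)"
    proof -
      have "real (card V) \<le> real ((2 * R + 1) ^ (s - 2))"
        unfolding V_def by (intro of_nat_mono card_radical_le)
      also have "\<dots> \<le> X ^ (s - 2)" unfolding of_nat_power using le[of 2] by (intro power_mono) (auto simp: b_def)
      finally show ?thesis .
    qed
    have cE: "real (card E) \<le> 5 * X ^ (s - 1)"
    proof -
      have "card E \<le> 2 * (4 * b1 * R + 1) ^ (s - 1) + 3 * (4 * b2 * R + 1) ^ (s - 1)"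
        unfolding E_def by (rule order_trans[OF card_Un_le add_mono[OF b1 b2]])
      then have "real (card E) \<le> real (2 * (4 * b1 * R + 1) ^ (s - 1) + 3 * (4 * b2 * R + 1) ^ (s - 1))"
        by (rule of_nat_mono)
      also have "\<dots> = 2 * real (4 * b1 * R + 1) ^ (s - 1) + 3 * real (4 * b2 * R + 1) ^ (s - 1)"
        by simp
      also have "\<dots> \<le> 2 * X ^ (s - 1) + 3 * X ^ (s - 1)"
        using le[of "4 * b1"] le[of "4 * b2"] by (intro add_mono mult_left_mono power_mono) (auto simp: b_def)
      finally show ?thesis by simp
    qed
    have Yq: "Y h = {y \<in> ?B. quadform {..<s} (\<lambda>k l. 3 * L k l h) y + T h h h = 0}" for h
      unfolding Y_def T_eq_quadform[of h] by (simp add: quadform_def sum_distrib_left mult_ac)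
    have Yall: "real (card (Y h)) \<le> X ^ s" for h
    proof -
      have "card (Y h) \<le> card ?B" unfolding Y_def by (intro card_mono fB) auto
      then show ?thesis using cB by linarith
    qed
    have Ymid: "real (card (Y h)) \<le> 2 * X ^ (s - 1)" if hB: "h \<in> ?B" and hV: "h \<notin> V" for h
    proof -
      obtain k l where kl: "k < s" "l < s" "L k l h \<noteq> 0" using hB hV by (auto simp: V_def)
      have "Y h = {y \<in> ?B. quadform {..<s} (\<lambda>k l. 3 * L k l h) y + (\<Sum>i<s. 0 * y i) + T h h h = 0}"
        unfolding Yq by simp
      also have "card \<dots> \<le> 2 * (4 * R + 1) ^ (card {..<s} - 1)"
        by (rule card_quadric_le[of _ _ k l]) (use kl L_sym in auto)
      finally have "real (card (Y h)) \<le> real (2 * (4 * R + 1) ^ (s - 1))"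
        unfolding card_lessThan by (rule of_nat_mono)
      also have "\<dots> = 2 * real (4 * R + 1) ^ (s - 1)" by simp
      also have "\<dots> \<le> 2 * X ^ (s - 1)"
        using le[of 4] by (intro mult_left_mono power_mono) (auto simp: b_def)
      finally show ?thesis .
    qed
    define G where "G = k * real R ^ (s - 2) * real R powr \<epsilon>"
    have G0: "G \<ge> 0" using k by (simp add: G_def)
    have Ygen: "real (card (Y h)) \<le> G" if hB: "h \<in> ?B" and hE: "h \<notin> E" for h
      unfolding Yq G_def
    proof (rule gen)
      show "3 * L i i h * (3 * L j j h) - (3 * L i j h)\<^sup>2 \<noteq> 0"
        using hB hE by (simp add: E_def power_mult_distrib)
      show "T h h h \<noteq> 0" using hB hE by (simp add: E_def)
      show "\<bar>3 * L k l h\<bar> \<le> int (A * R)" if "k < s" "l < s" for k l by (rule A(2)[OF hB that])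
    qed (use ij R L_sym in auto)
    \<comment> \<open>The bounds are added instead of selected, so that the sum over
      \<open>h\<close> splits although \<open>V\<close> and \<open>E\<close> overlap.\<close>
    have Yb: "real (card (Y h)) \<le> (if h \<in> V then X ^ s else 0) + (if h \<in> E then 2 * X ^ (s - 1) else 0) + G"
      if "h \<in> ?B" for h
    proof -
      have "0 \<le> X ^ s" "0 \<le> 2 * X ^ (s - 1)" using X1 by simp_all
      then show ?thesis using Yall[of h] Ymid[OF that] Ygen[OF that] G0
        by (cases "h \<in> V"; cases "h \<in> E") simp_all
    qed
    have "{(h, y) \<in> ?B \<times> ?B. 3 * T h y y + T h h h = 0} = Sigma ?B Y" by (auto simp: Y_def)
    moreover have "card (Sigma ?B Y) = (\<Sum>h\<in>?B. card (Y h))"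
      by (rule card_SigmaI[OF fB]) (auto simp: Y_def fB)
    ultimately have "real (card {(h, y) \<in> ?B \<times> ?B. 3 * T h y y + T h h h = 0}) = (\<Sum>h\<in>?B. real (card (Y h)))"
      by simp
    also have "\<dots> \<le> (\<Sum>h\<in>?B. (if h \<in> V then X ^ s else 0) + (if h \<in> E then 2 * X ^ (s - 1) else 0) + G)"
      by (intro sum_mono Yb)
    also have "\<dots> = real (card V) * X ^ s + real (card E) * (2 * X ^ (s - 1)) + real (card ?B) * G"
    proof -
      have "?B \<inter> V = V" "?B \<inter> E = E" by (auto simp: V_def E_def)
      then have "(\<Sum>h\<in>?B. if h \<in> V then X ^ s else 0) = real (card V) * X ^ s"
        "(\<Sum>h\<in>?B. if h \<in> E then 2 * X ^ (s - 1) else 0) = real (card E) * (2 * X ^ (s - 1))"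
        unfolding sum.inter_restrict[OF fB, symmetric] by simp_all
      then show ?thesis unfolding sum.distrib by simp
    qed
    also have "\<dots> \<le> X ^ (s - 2) * X ^ s + 5 * X ^ (s - 1) * (2 * X ^ (s - 1)) + X ^ s * G"
      using cV cE cB X1 G0 by (intro add_mono mult_right_mono) auto
    also have "\<dots> = 11 * X ^ (2 * s - 2) + X ^ s * G"
    proof -
      have "X ^ (s - 2) * X ^ s = X ^ (2 * s - 2)" "X ^ (s - 1) * X ^ (s - 1) = X ^ (2 * s - 2)"
        using s_ge_2 by (simp_all add: mult_2 numeral_2_eq_2 flip: power_add)
      then show ?thesis by simp
    qed
    also have "11 * X ^ (2 * s - 2) \<le> 11 * real b ^ (2 * s) * real R ^ (2 * s - 2) * real R powr \<epsilon>"
    proof -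
      have "X ^ (2 * s - 2) = real b ^ (2 * s - 2) * real R ^ (2 * s - 2)"
        by (simp add: X_def power_mult_distrib)
      also have "\<dots> \<le> real b ^ (2 * s) * real R ^ (2 * s - 2)"
        using b1' by (intro mult_right_mono power_increasing) auto
      also have "\<dots> \<le> real b ^ (2 * s) * real R ^ (2 * s - 2) * real R powr \<epsilon>"
        using mult_left_mono[of 1 "real R powr \<epsilon>" "real b ^ (2 * s) * real R ^ (2 * s - 2)"] R e
        by (simp add: ge_one_powr_ge_zero)
      finally show ?thesis by simp
    qed
    also have "X ^ s * G \<le> real b ^ (2 * s) * k * real R ^ (2 * s - 2) * real R powr \<epsilon>"
    proof -
      have "X ^ s * G = real b ^ s * k * (real R ^ s * real R ^ (s - 2)) * real R powr \<epsilon>"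
        by (simp add: X_def G_def power_mult_distrib mult_ac)
      also have "real R ^ s * real R ^ (s - 2) = real R ^ (2 * s - 2)"
        using s_ge_2 by (simp add: mult_2 flip: power_add)
      also have "real b ^ s * k * real R ^ (2 * s - 2) * real R powr \<epsilon>
          \<le> real b ^ (2 * s) * k * real R ^ (2 * s - 2) * real R powr \<epsilon>"
        using b1' k by (intro mult_right_mono power_increasing) auto
      finally show ?thesis .
    qed
    finally show ?thesis by (simp add: K_def algebra_simps)
  qed
  moreover have "K \<ge> 0" using k by (simp add: K_def)
  ultimately show ?thesis by blast
qed

end

end

section \<open>Polarization of a cubic form\<close>

abbreviation expo :: "nat \<Rightarrow> nat \<Rightarrow>\<^sub>0 nat" where
  "expo i \<equiv> Poly_Mapping.single i 1"

lemma monomial_degree_Suc: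
  fixes m :: "nat \<Rightarrow>\<^sub>0 nat"
  assumes m: "Poly_Mapping.keys m \<subseteq> {..<s}" and d: "(\<Sum>i<s. Poly_Mapping.lookup m i) = Suc n"
  obtains i m' where "i < s" "m = expo i + m'" "Poly_Mapping.keys m' \<subseteq> {..<s}"
    "(\<Sum>i<s. Poly_Mapping.lookup m' i) = n"
proof -
  have "\<exists>i<s. Poly_Mapping.lookup m i \<noteq> 0"
  proof (rule ccontr)
    assume "\<not> ?thesis"
    then have "(\<Sum>i<s. Poly_Mapping.lookup m i) = 0" by simp
    with d show False by simp
  qed
  then obtain i where i: "i < s" "Poly_Mapping.lookup m i \<noteq> 0" by blast
  have eq: "m = expo i + (m - expo i)"
    using i by (intro poly_mapping_eqI) (auto simp: lookup_add lookup_minus lookup_single when_def)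
  have "Poly_Mapping.keys (m - expo i) \<subseteq> {..<s}"
  proof
    fix x assume "x \<in> Poly_Mapping.keys (m - expo i)"
    then have "Poly_Mapping.lookup m x \<noteq> 0" by (auto simp: in_keys_iff lookup_minus)
    then show "x \<in> {..<s}" using m by (auto simp: in_keys_iff subset_iff)
  qed
  moreover have "(\<Sum>l<s. Poly_Mapping.lookup m l) = 1 + (\<Sum>l<s. Poly_Mapping.lookup (m - expo i) l)"
    by (subst eq) (use i in \<open>simp add: lookup_add sum.distrib lookup_single when_def\<close>)
  ultimately show ?thesis using that[OF i(1) eq] d by simp
qed

lemma cubic_monomial:
  fixes m :: "nat \<Rightarrow>\<^sub>0 nat"
  assumes m: "Poly_Mapping.keys m \<subseteq> {..<s}" and d: "(\<Sum>i\<in>Poly_Mapping.keys m. Poly_Mapping.lookup m i) = 3"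
  shows "\<exists>i j k. i < s \<and> j < s \<and> k < s \<and> m = expo i + expo j + expo k"
proof -
  have "(\<Sum>i<s. Poly_Mapping.lookup m i) = 3"
    using d m by (subst sum.mono_neutral_right[of "{..<s}" "Poly_Mapping.keys m"]) (auto simp: in_keys_iff)
  then obtain i m1 where 1: "i < s" "m = expo i + m1" "Poly_Mapping.keys m1 \<subseteq> {..<s}"
    "(\<Sum>i<s. Poly_Mapping.lookup m1 i) = 2"
    using monomial_degree_Suc[OF m, of 2] by auto
  then obtain j m2 where 2: "j < s" "m1 = expo j + m2" "Poly_Mapping.keys m2 \<subseteq> {..<s}"
    "(\<Sum>i<s. Poly_Mapping.lookup m2 i) = 1"
    using monomial_degree_Suc[OF 1(3), of 1] by auto
  then obtain k m3 where 3: "k < s" "m2 = expo k + m3" "Poly_Mapping.keys m3 \<subseteq> {..<s}"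
    "(\<Sum>i<s. Poly_Mapping.lookup m3 i) = 0"
    using monomial_degree_Suc[OF 2(3), of 0] by auto
  then have "m3 = 0" by (intro poly_mapping_eqI) (auto simp: in_keys_iff subset_iff)
  then show ?thesis using 1 2 3 by (auto simp: add.assoc)
qed

lemma monomial_value:
  fixes x :: "nat \<Rightarrow> int"
  assumes "i < s" "j < s" "k < s"
  defines "m \<equiv> expo i + expo j + expo k"
  shows "(\<Prod>l\<in>Poly_Mapping.keys m. x l ^ Poly_Mapping.lookup m l) = x i * x j * x k"
proof -
  have e: "(\<Prod>l<s. x l ^ Poly_Mapping.lookup (expo a) l) = x a" if "a < s" for a
  proof -
    have "(\<Prod>l<s. x l ^ Poly_Mapping.lookup (expo a) l) = (\<Prod>l<s. if l = a then x l else 1)"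
      by (intro prod.cong refl) (simp add: lookup_single when_def)
    then show ?thesis using that by simp
  qed
  have "Poly_Mapping.keys m \<subseteq> {..<s}"
    using assms by (auto simp: in_keys_iff lookup_add lookup_single when_def split: if_splits)
  then have "(\<Prod>l\<in>Poly_Mapping.keys m. x l ^ Poly_Mapping.lookup m l) = (\<Prod>l<s. x l ^ Poly_Mapping.lookup m l)"
    by (intro prod.mono_neutral_left) (auto simp: in_keys_iff)
  also have "\<dots> = x i * x j * x k"
    using assms e by (simp add: m_def lookup_add power_add prod.distrib)
  finally show ?thesis .
qed

section \<open>Integral symmetrization of monomials\<close>

definition kron :: "nat \<Rightarrow> nat \<Rightarrow> int" where
  "kron i a = (if a = i then 1 else 0)"

text \<open>The sum over all six permutations, undivided, so that entries stay integral even when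
  indices coincide. This is the origin of the factor 6 in \<open>6 * meval C x\<close>.\<close>

definition kron_sym :: "nat \<Rightarrow> nat \<Rightarrow> nat \<Rightarrow> nat \<Rightarrow> nat \<Rightarrow> nat \<Rightarrow> int" where
  "kron_sym i j k a b c =
     kron i a * kron j b * kron k c + kron i a * kron k b * kron j c
   + kron j a * kron i b * kron k c + kron j a * kron k b * kron i c
   + kron k a * kron i b * kron j c + kron k a * kron j b * kron i c"

lemma sum_kron:
  fixes F :: "nat \<Rightarrow> 'a::comm_ring_1"
  assumes "i < s"
  shows "(\<Sum>a<s. of_int (kron i a) * F a) = F i"
proof -
  have "(\<Sum>a<s. of_int (kron i a) * F a) = (\<Sum>a<s. if a = i then F a else 0)"
    by (intro sum.cong refl) (simp add: kron_def)
  then show ?thesis using assms by simp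
qed

lemma sum_kron3:
  fixes F :: "nat \<Rightarrow> nat \<Rightarrow> nat \<Rightarrow> 'a::comm_ring_1"
  assumes "i < s" "j < s" "k < s"
  shows "(\<Sum>a<s. \<Sum>b<s. \<Sum>c<s. of_int (kron i a * kron j b * kron k c) * F a b c) = F i j k"
proof -
  have "(\<Sum>a<s. \<Sum>b<s. \<Sum>c<s. of_int (kron i a * kron j b * kron k c) * F a b c)
    = (\<Sum>a<s. of_int (kron i a) * (\<Sum>b<s. of_int (kron j b) * (\<Sum>c<s. of_int (kron k c) * F a b c)))"
    by (simp add: sum_distrib_left mult_ac)
  then show ?thesis using assms by (simp add: sum_kron)
qed

lemma sum_kron_sym:
  fixes F :: "nat \<Rightarrow> nat \<Rightarrow> nat \<Rightarrow> 'a::comm_ring_1"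
  assumes "i < s" "j < s" "k < s"
  shows "(\<Sum>a<s. \<Sum>b<s. \<Sum>c<s. of_int (kron_sym i j k a b c) * F a b c)
    = F i j k + F i k j + F j i k + F j k i + F k i j + F k j i"
  unfolding kron_sym_def of_int_add distrib_right sum.distrib
  by (simp only: sum_kron3 assms)

text \<open>One index triple is chosen for each monomial and symmetrized. The last clause turns a
  rank-one shape of \<open>t\<close> into an identity of polynomials, so that it can contradict the
  hypothesis on \<open>C\<close>.\<close>

lemma cubic_form_polarization:
  fixes C :: "int mpolynomial"
  assumes C: "cubic_form s C"
  obtains t :: "nat \<Rightarrow> nat \<Rightarrow> nat \<Rightarrow> int"
  where "\<And>i j k. t i j k = t j i k" "\<And>i j k. t i j k = t i k j"
    "\<And>x. 6 * meval C x = (\<Sum>i<s. \<Sum>j<s. \<Sum>k<s. t i j k * x i * x j * x k)"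
    "\<And>(a::rat) b. \<forall>i<s. \<forall>j<s. \<forall>k<s. of_int (t i j k) = a * b i * b j * b k
      \<Longrightarrow> rational_multiple_of_cube s C"
proof -
  let ?M = "Poly_Mapping.keys C" and ?c = "Poly_Mapping.lookup C"
  have "\<forall>m\<in>?M. \<exists>i j k. i < s \<and> j < s \<and> k < s \<and> m = expo i + expo j + expo k"
    using cubic_monomial C by (simp add: cubic_form_def)
  then obtain p q r where "\<forall>m\<in>?M. p m < s \<and> q m < s \<and> r m < s \<and> m = expo (p m) + expo (q m) + expo (r m)"
    by metis
  then have lt: "p m < s" "q m < s" "r m < s" and eq: "m = expo (p m) + expo (q m) + expo (r m)"
    if "m \<in> ?M" for m
    using that by blast+
  define t where "t = (\<lambda>a b c. \<Sum>m\<in>?M. ?c m * kron_sym (p m) (q m) (r m) a b c)"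
  \<comment> \<open>Stated over an arbitrary ring because it is applied twice: over the integers to
    evaluate \<open>C\<close>, and over the rationals to compare coefficients.\<close>
  have contract: "(\<Sum>a<s. \<Sum>b<s. \<Sum>c<s. of_int (t a b c) * F a b c)
      = (\<Sum>m\<in>?M. of_int (?c m) * (\<Sum>a<s. \<Sum>b<s. \<Sum>c<s. of_int (kron_sym (p m) (q m) (r m) a b c) * F a b c))"
    for F :: "nat \<Rightarrow> nat \<Rightarrow> nat \<Rightarrow> 'b::comm_ring_1"
  proof -
    have "(\<Sum>a<s. \<Sum>b<s. \<Sum>c<s. of_int (t a b c) * F a b c)
      = (\<Sum>a<s. \<Sum>b<s. \<Sum>c<s. \<Sum>m\<in>?M. of_int (?c m) * of_int (kron_sym (p m) (q m) (r m) a b c) * F a b c)"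
      by (simp add: t_def sum_distrib_right)
    also have "\<dots> = (\<Sum>a<s. \<Sum>b<s. \<Sum>m\<in>?M. \<Sum>c<s. of_int (?c m) * of_int (kron_sym (p m) (q m) (r m) a b c) * F a b c)"
      by (intro sum.cong refl sum.swap)
    also have "\<dots> = (\<Sum>a<s. \<Sum>m\<in>?M. \<Sum>b<s. \<Sum>c<s. of_int (?c m) * of_int (kron_sym (p m) (q m) (r m) a b c) * F a b c)"
      by (rule sum.cong[OF refl], rule sum.swap)
    also have "\<dots> = (\<Sum>m\<in>?M. \<Sum>a<s. \<Sum>b<s. \<Sum>c<s. of_int (?c m) * of_int (kron_sym (p m) (q m) (r m) a b c) * F a b c)"
      by (rule sum.swap)
    finally show ?thesis by (simp add: sum_distrib_left mult.assoc)
  qed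
  have ev: "6 * meval C x = (\<Sum>i<s. \<Sum>j<s. \<Sum>k<s. t i j k * x i * x j * x k)" for x
  proof -
    have "(\<Sum>i<s. \<Sum>j<s. \<Sum>k<s. t i j k * x i * x j * x k)
      = (\<Sum>i<s. \<Sum>j<s. \<Sum>k<s. of_int (t i j k) * (x i * x j * x k))" by (simp add: mult_ac)
    also have "\<dots> = (\<Sum>m\<in>?M. ?c m * (6 * (x (p m) * x (q m) * x (r m))))"
      unfolding contract by (intro sum.cong refl) (simp add: sum_kron_sym[where 'a = int, simplified] lt)
    also have "\<dots> = (\<Sum>m\<in>?M. 6 * (?c m * (\<Prod>l\<in>Poly_Mapping.keys m. x l ^ Poly_Mapping.lookup m l)))"
    proof (intro sum.cong refl)
      fix m assume m: "m \<in> ?M"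
      show "?c m * (6 * (x (p m) * x (q m) * x (r m)))
        = 6 * (?c m * (\<Prod>l\<in>Poly_Mapping.keys m. x l ^ Poly_Mapping.lookup m l))"
        using monomial_value[OF lt[OF m], of x] eq[OF m] by simp
    qed
    finally show ?thesis by (simp add: meval_def sum_distrib_left)
  qed
  have cube: "rational_multiple_of_cube s C"
    if ab: "\<forall>i<s. \<forall>j<s. \<forall>k<s. of_int (t i j k) = a * b i * b j * b k" for a :: rat and b
  proof -
    have X: "(\<Sum>i<s. mconst (b i) * mvar i) = (\<Sum>i<s. Poly_Mapping.single (expo i) (b i))"
      by (simp add: mconst_def mvar_def mult_single)
    have "mconst (a / 6) * (\<Sum>i<s. mconst (b i) * mvar i) ^ 3
      = (\<Sum>i<s. \<Sum>j<s. \<Sum>k<s. Poly_Mapping.single (expo i + expo j + expo k) (a / 6 * b i * b j * b k))"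
      unfolding X power3_eq_cube sum_product sum_distrib_left sum_distrib_right
      by (simp add: mconst_def mult_single mult_ac add_ac)
    also have "\<dots> = (\<Sum>i<s. \<Sum>j<s. \<Sum>k<s. Poly_Mapping.single (expo i + expo j + expo k) (of_int (t i j k) / 6 :: rat))"
      using ab by (intro sum.cong refl) simp
    also have "\<dots> = Poly_Mapping.map of_int C"
    proof (rule poly_mapping_eqI)
      fix N
      \<comment> \<open>Contraction with this weight extracts the coefficient at \<open>N\<close>:
        the six permutations of a triple yield the same monomial, each with weight one
        sixth.\<close>
      let ?F = "\<lambda>i j k. (1 / 6 when expo i + expo j + expo k = N) :: rat"
      have "Poly_Mapping.lookup (\<Sum>i<s. \<Sum>j<s. \<Sum>k<s. Poly_Mapping.single (expo i + expo j + expo k) (of_int (t i j k) / 6 :: rat)) N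
        = (\<Sum>i<s. \<Sum>j<s. \<Sum>k<s. of_int (t i j k) * ?F i j k)"
        by (simp add: lookup_sum lookup_single when_def if_distrib cong: if_cong)
      also have "\<dots> = (\<Sum>m\<in>?M. of_int (?c m) * (1 when m = N))"
        unfolding contract
      proof (intro sum.cong refl)
        fix m assume m: "m \<in> ?M"
        show "of_int (?c m) * (\<Sum>a<s. \<Sum>b<s. \<Sum>c<s. of_int (kron_sym (p m) (q m) (r m) a b c) * ?F a b c)
          = of_int (?c m) * (1 when m = N)"
          unfolding sum_kron_sym[OF lt[OF m]] using eq[OF m] by (auto simp: when_def add_ac)
      qed
      also have "\<dots> = Poly_Mapping.lookup (Poly_Mapping.map of_int C) N"
        by (auto simp: Poly_Mapping.map.rep_eq when_def in_keys_iff if_distrib cong: if_cong)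
      finally show "Poly_Mapping.lookup (\<Sum>i<s. \<Sum>j<s. \<Sum>k<s. Poly_Mapping.single (expo i + expo j + expo k) (of_int (t i j k) / 6 :: rat)) N
        = Poly_Mapping.lookup (Poly_Mapping.map of_int C) N" .
    qed
    finally show ?thesis unfolding rational_multiple_of_cube_def by metis
  qed
  have sym: "t i j k = t j i k" "t i j k = t i k j" for i j k
    unfolding t_def kron_sym_def by (intro sum.cong refl, simp add: mult_ac add_ac)+
  show ?thesis by (rule that[OF sym ev cube])
qed

section \<open>The number of pairs\<close>

theorem theorem1p1:
  fixes s :: nat and C :: "int mpolynomial"
  assumes "s \<ge> 2"
    and "cubic_form s C"
    and "\<not> rational_multiple_of_cube s C"
  shows "\<forall>\<epsilon>::real. \<epsilon> > 0 \<longrightarrow> (\<exists>K::real. \<forall>P::real. P \<ge> 1 \<longrightarrow>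
           real (num_pairs s C P) \<le> K * P powr (2 * real s - 2 + \<epsilon>))"
proof (intro allI impI)
  fix \<epsilon> :: real assume e: "\<epsilon> > 0"
  show "\<exists>K. \<forall>P\<ge>1. real (num_pairs s C P) \<le> K * P powr (2 * real s - 2 + \<epsilon>)"
  proof (rule cubic_form_polarization[OF assms(2)])
    fix t :: "nat \<Rightarrow> nat \<Rightarrow> nat \<Rightarrow> int"
    assume sym: "\<And>i j k. t i j k = t j i k" "\<And>i j k. t i j k = t i k j"
      and tC: "\<And>x. 6 * meval C x = (\<Sum>i<s. \<Sum>j<s. \<Sum>k<s. t i j k * x i * x j * x k)"
      and cube: "\<And>(a::rat) b. \<forall>i<s. \<forall>j<s. \<forall>k<s. of_int (t i j k) = a * b i * b j * b k
        \<Longrightarrow> rational_multiple_of_cube s C"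
    interpret symmetric_trilinear s t by unfold_locales (fact sym)+
    have TC: "T x x x = 6 * meval C x" for x by (simp add: T_def tC)
    have "\<exists>i<s. \<exists>j<s. \<exists>h. L i i h * L j j h \<noteq> L i j h ^ 2"
    proof (rule ccontr)
      assume "\<not> ?thesis"
      then have "\<And>i j h. i < s \<Longrightarrow> j < s \<Longrightarrow> L i i h * L j j h = L i j h ^ 2" by blast
      from cube_of_minors_zero[OF this] obtain a :: rat and b
        where "\<forall>i<s. \<forall>j<s. \<forall>k<s. of_int (t i j k) = a * b i * b j * b k" by blast
      then show False using cube assms(3) by blast
    qed
    then obtain i j h0 where ij: "i < s" "j < s" and h0: "L i i h0 * L j j h0 \<noteq> L i j h0 ^ 2"
      by blast
    obtain K where K: "K \<ge> 0" and count: "\<And>R. R \<ge> 1 \<Longrightarrow>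
        real (card {(h, y) \<in> box {..<s} R \<times> box {..<s} R. 3 * T h y y + T h h h = 0})
          \<le> K * real R ^ (2 * s - 2) * real R powr \<epsilon>"
      using difference_equation_count[OF ij h0 e] by blast
    show ?thesis
    proof (intro exI allI impI)
      fix P :: real assume P: "P \<ge> 1"
      \<comment> \<open>Sums and differences of coordinates reach \<open>2 * P\<close>, and being
        integers they obey the rounded bound.\<close>
      define R where "R = nat \<lfloor>2 * P\<rfloor>"
      have R1: "R \<ge> 1" and RP: "real R \<le> 2 * P" using P by (simp_all add: R_def le_nat_iff le_floor_iff)
      let ?A = "{(x, X). x \<in> int_box s P \<and> X \<in> int_box s P \<and> meval C x = meval C X}"
      let ?B = "{(h, y) \<in> box {..<s} R \<times> box {..<s} R. 3 * T h y y + T h h h = 0}"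
      let ?f = "\<lambda>(x :: nat \<Rightarrow> int, X :: nat \<Rightarrow> int).
        (restrict (\<lambda>i. x i - X i) {..<s}, restrict (\<lambda>i. x i + X i) {..<s})"
      \<comment> \<open>Only an injection: the image consists of pairs with coordinates of equal
        parity, and this condition is dropped.\<close>
      have "card ?A \<le> card ?B"
      proof (rule card_inj_on_le)
        show "inj_on ?f ?A"
        proof (rule inj_onI, clarify)
          fix x X y Y assume b: "x \<in> int_box s P" "X \<in> int_box s P" "y \<in> int_box s P" "Y \<in> int_box s P"
            and e1: "restrict (\<lambda>i. x i - X i) {..<s} = restrict (\<lambda>i. y i - Y i) {..<s}"
            and e2: "restrict (\<lambda>i. x i + X i) {..<s} = restrict (\<lambda>i. y i + Y i) {..<s}"
          have "x i = y i \<and> X i = Y i" if "i \<in> {..<s}" for i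
          proof -
            have "x i - X i = y i - Y i" "x i + X i = y i + Y i"
              using fun_cong[OF e1, of i] fun_cong[OF e2, of i] that by simp_all
            then show ?thesis by linarith
          qed
          then show "x = y \<and> X = Y" using b unfolding int_box_def by (blast intro: PiE_ext)
        qed
        show "?f ` ?A \<subseteq> ?B"
        proof clarify
          fix x X assume b: "x \<in> int_box s P" "X \<in> int_box s P" and eq: "meval C x = meval C X"
          let ?h = "restrict (\<lambda>i. x i - X i) {..<s}" and ?y = "restrict (\<lambda>i. x i + X i) {..<s}"
          have le: "\<bar>x i - X i\<bar> \<le> int R \<and> \<bar>x i + X i\<bar> \<le> int R" if "i \<in> {..<s}" for i
          proof -
            have "\<bar>real_of_int (x i)\<bar> \<le> P" "\<bar>real_of_int (X i)\<bar> \<le> P"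
              using b that by (auto simp: int_box_def PiE_def Pi_def abs_le_iff minus_le_iff)
            then have "real_of_int \<bar>x i - X i\<bar> \<le> 2 * P" "real_of_int \<bar>x i + X i\<bar> \<le> 2 * P"
              by linarith+
            then show ?thesis using P by (simp_all add: R_def le_floor_iff)
          qed
          then have "?h \<in> box {..<s} R" "?y \<in> box {..<s} R" by (auto intro!: restrict_in_box)
          moreover have "3 * T ?h ?y ?y + T ?h ?h ?h = 0"
            using cube_eq_iff[of ?h x X ?y] eq by (simp add: TC)
          ultimately show "(?h, ?y) \<in> box {..<s} R \<times> box {..<s} R \<and> 3 * T ?h ?y ?y + T ?h ?h ?h = 0"
            by blast
        qed
        show "finite ?B"
          by (rule finite_subset[of _ "box {..<s} R \<times> box {..<s} R"]) (auto simp: finite_box)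
      qed
      then have "real (num_pairs s C P) \<le> K * real R ^ (2 * s - 2) * real R powr \<epsilon>"
        unfolding num_pairs_def using count[OF R1] by linarith
      also have "\<dots> = K * real R powr (2 * real s - 2 + \<epsilon>)"
      proof -
        have "real R ^ (2 * s - 2) = real R powr real (2 * s - 2)"
          using R1 by (simp add: powr_realpow)
        also have "real (2 * s - 2) = 2 * real s - 2" using assms(1) by simp
        finally show ?thesis by (simp add: powr_add)
      qed
      also have "\<dots> \<le> K * (2 * P) powr (2 * real s - 2 + \<epsilon>)"
        using K RP e assms(1) by (intro mult_left_mono powr_mono2) auto
      also have "\<dots> = K * 2 powr (2 * real s - 2 + \<epsilon>) * P powr (2 * real s - 2 + \<epsilon>)"
        using P by (simp add: powr_mult)
      finally show "real (num_pairs s C P)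
        \<le> K * 2 powr (2 * real s - 2 + \<epsilon>) * P powr (2 * real s - 2 + \<epsilon>)" .
    qed
  qed
qed

end
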